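(* Let $F$ be a finite field of characteristic $p$ with $|F|=q=p^k$ and let $G=C_4 \times D_6$. If $p>3$, then $$U(FG) \cong \begin{cases} C_{p^k-1}^8 \times GL(2,F)^4, & \text{if } q \equiv 1 \text{ or } 5 \bmod 12;\\ C_{p^k-1}^4 \times C_{p^{2k}-1}^2 \times GL(2, F)^2 \times GL(2, F_2), & \text{if } q \equiv -1 \text{ or } -5 \bmod 12.\end{cases}$$
   Context: $FG$ denotes the group algebra of a finite group $G$ over $F$, and $U(FG)$ its group of units. $C_n$ is the cyclic group of order $n$, $D_n$ is the dihedral group of order $n$ (so $D_6$ has order $6$), and $H^m$ denotes the direct product of $m$ copies of a group $H$. $F_2$ denotes the extension field of $F$ of degree $2$ (so $|F_2|=q^2$). *)

theory Defs
  imports "HOL-Algebra.Algebra" "HOL-Number_Theory.Cong"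
begin

text \<open>The additive order of the identity; \<open>ord\<close> is 0 for elements of infinite order.\<close>

definition characteristic :: "('a, 'm) ring_scheme \<Rightarrow> nat" where
  "characteristic R = group.ord (add_monoid R) \<one>\<^bsub>R\<^esub>"

text \<open>For a field \<open>F\<close>: \<open>E\<close> is a field with \<open>[E : F] = n\<close>. The field \<open>F\<close> sits inside \<open>E\<close> via
  some embedding, since the two fields may live on different types.\<close>

definition extension_of_degree ::
    "nat \<Rightarrow> ('a, 'm) ring_scheme \<Rightarrow> ('b, 'n) ring_scheme \<Rightarrow> bool" where
  "extension_of_degree n F E \<longleftrightarrow>
     field E \<and> (\<exists>h \<in> ring_hom F E. ring.dimension E n (h ` carrier F) (carrier E))"

text \<open>For a finite group \<open>G\<close>, the formal sum of the \<open>f x \<cdot> x\<close> is represented by its coefficient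
  function \<open>f\<close>, which is extensional on \<open>carrier G\<close>.\<close>

definition group_algebra ::
    "('a, 'm) ring_scheme \<Rightarrow> ('g, 'n) monoid_scheme \<Rightarrow> ('g \<Rightarrow> 'a) ring" where
  "group_algebra R G =
    \<lparr>carrier = carrier G \<rightarrow>\<^sub>E carrier R,
     Group.monoid.mult = (\<lambda>f g. \<lambda>x\<in>carrier G.
       (\<Oplus>\<^bsub>R\<^esub>y\<in>carrier G. f y \<otimes>\<^bsub>R\<^esub> g (inv\<^bsub>G\<^esub> y \<otimes>\<^bsub>G\<^esub> x))),
     Group.monoid.one = (\<lambda>x\<in>carrier G. if x = \<one>\<^bsub>G\<^esub> then \<one>\<^bsub>R\<^esub> else \<zero>\<^bsub>R\<^esub>),
     Ring.ring.zero = (\<lambda>x\<in>carrier G. \<zero>\<^bsub>R\<^esub>),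
     Ring.ring.add = (\<lambda>f g. \<lambda>x\<in>carrier G. f x \<oplus>\<^bsub>R\<^esub> g x)\<rparr>"

definition matrix_ring :: "nat \<Rightarrow> ('a, 'm) ring_scheme \<Rightarrow> (nat \<times> nat \<Rightarrow> 'a) ring" where
  "matrix_ring n R =
    \<lparr>carrier = {..<n} \<times> {..<n} \<rightarrow>\<^sub>E carrier R,
     Group.monoid.mult = (\<lambda>A B. \<lambda>(i, j)\<in>{..<n} \<times> {..<n}.
       (\<Oplus>\<^bsub>R\<^esub>l\<in>{..<n}. A (i, l) \<otimes>\<^bsub>R\<^esub> B (l, j))),
     Group.monoid.one = (\<lambda>(i, j)\<in>{..<n} \<times> {..<n}. if i = j then \<one>\<^bsub>R\<^esub> else \<zero>\<^bsub>R\<^esub>),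
     Ring.ring.zero = (\<lambda>(i, j)\<in>{..<n} \<times> {..<n}. \<zero>\<^bsub>R\<^esub>),
     Ring.ring.add = (\<lambda>A B. \<lambda>(i, j)\<in>{..<n} \<times> {..<n}. A (i, j) \<oplus>\<^bsub>R\<^esub> B (i, j))\<rparr>"

definition GL :: "nat \<Rightarrow> ('a, 'm) ring_scheme \<Rightarrow> (nat \<times> nat \<Rightarrow> 'a) monoid" where
  "GL n R = units_of (matrix_ring n R)"

text \<open>The dihedral group of order \<open>m\<close> (for even \<open>m > 0\<close>), so it has \<open>m div 2\<close> rotations. The pair
  \<open>(i, a)\<close> stands for \<open>r\<^sup>i s\<^sup>a\<close>, where \<open>s r = r\<^sup>-\<^sup>1 s\<close>.\<close>

definition dihedral_group :: "nat \<Rightarrow> (int \<times> bool) monoid" where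
  "dihedral_group m =
    \<lparr>carrier = {0..<int (m div 2)} \<times> UNIV,
     Group.monoid.mult = (\<lambda>(i, a) (j, b). ((if a then i - j else i + j) mod int (m div 2), a \<noteq> b)),
     Group.monoid.one = (0, False)\<rparr>"

definition group_power :: "('a, 'm) monoid_scheme \<Rightarrow> nat \<Rightarrow> (nat \<Rightarrow> 'a) monoid" where
  "group_power H m = product_group {..<m} (\<lambda>_. H)"

end

theory Submission
  imports Defs
begin

text \<open>Extend representations of \<open>C\<^sub>4 \<times> D\<^sub>6\<close> linearly to the group algebra. A fourth root of unity \<open>z\<close> in
  \<open>F\<close> (or in \<open>F\<^sub>2\<close>, for a square root of \<open>-1\<close> that is missing in \<open>F\<close>), combined with the two linear
  characters and the two-dimensional representation of \<open>D\<^sub>6\<close>, gives two maps to the field and one to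
  the ring of \<open>2 \<times> 2\<close> matrices. Jointly these maps are injective by Fourier inversion, which only needs
  that 2 and 3 are invertible; both sides have \<open>q\<^sup>2\<^sup>4\<close> elements, so they form an isomorphism of
  multiplicative monoids, and it remains to take units. When \<open>-1\<close> is not a square in \<open>F\<close>, a square
  root \<open>w\<close> in \<open>F\<^sub>2\<close> separates the two coefficients of \<open>a + b w\<close>, so a single evaluation at \<open>w\<close>
  replaces the evaluations at \<open>w\<close> and \<open>-w\<close>.\<close>

text \<open>Two kinds of roots of unity could enter: fourth roots from the cyclic factor and cube
  roots from the rotations. The latter never do: the two-dimensional representation of
  \<open>D_6\<close> is taken in a basis where its entries are 0, 1 and -1, so it exists over every
  field. Hence only q mod 4 matters: among the residues prime to 12, those congruent to 1 mod 4 are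
  1 and 5, and those congruent to 3 mod 4 are -1 and -5.

  An explicit map replaces the structure theory of semisimple algebras. Since units depend on the
  product alone, it is shown to preserve products and the identity, and injectivity is obtained by
  recovering coefficients, not from a kernel. The recovery has two stages. An element of the group
  algebra is read as a function on \<open>D_6\<close> whose values are polynomials of degree at most
  3 in a generator of \<open>C_4\<close>. For each fixed root z the dihedral transform gives back
  the values of these polynomials at z; the cyclic transform then gives back their coefficients.

  The exponent 24 of q arises as 8 + 4*4 in the first case and as 4 + 2*2 + 2*4 + 2*4 in the
  second.\<close>

lemma (in abelian_monoid) finsum_swap:
  assumes "finite A" "finite B" "\<And>a b. a \<in> A \<Longrightarrow> b \<in> B \<Longrightarrow> f a b \<in> carrier G"
  shows "(\<Oplus>a\<in>A. \<Oplus>b\<in>B. f a b) = (\<Oplus>b\<in>B. \<Oplus>a\<in>A. f a b)"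
  using assms(1,3)
proof (induction A rule: finite_induct)
  case empty
  then show ?case by (simp add: finsum_zero)
next
  case (insert x A)
  have "(\<Oplus>a\<in>insert x A. \<Oplus>b\<in>B. f a b) = (\<Oplus>b\<in>B. f x b) \<oplus> (\<Oplus>b\<in>B. \<Oplus>a\<in>A. f a b)"
    using insert by (subst finsum_insert) (auto intro!: finsum_closed)
  also have "\<dots> = (\<Oplus>b\<in>B. f x b \<oplus> (\<Oplus>a\<in>A. f a b))"
    using insert by (subst finsum_addf) (auto intro!: finsum_closed)
  also have "\<dots> = (\<Oplus>b\<in>B. \<Oplus>a\<in>insert x A. f a b)"
    using insert by (intro finsum_cong') (auto intro!: finsum_closed)
  finally show ?case .
qed

text \<open>The second coordinate becomes the outer sum, so that on \<open>C_4 \<times> D_6\<close>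
  the cyclic coordinate is summed up for each fixed dihedral element.\<close>

lemma (in abelian_monoid) finsum_Times:
  assumes "finite A" "finite B" "\<And>a b. a \<in> A \<Longrightarrow> b \<in> B \<Longrightarrow> f (a, b) \<in> carrier G"
  shows "(\<Oplus>x\<in>A \<times> B. f x) = (\<Oplus>b\<in>B. \<Oplus>a\<in>A. f (a, b))"
  using assms(2,3)
proof (induction B rule: finite_induct)
  case empty
  then show ?case by simp
next
  case (insert y B)
  have eq: "A \<times> insert y B = (\<lambda>a. (a, y)) ` A \<union> A \<times> B" by auto
  have "(\<Oplus>x\<in>A \<times> insert y B. f x) = (\<Oplus>x\<in>(\<lambda>a. (a, y)) ` A. f x) \<oplus> (\<Oplus>x\<in>A \<times> B. f x)"
    unfolding eq using insert assms(1) by (intro finsum_Un_disjoint) auto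
  also have "(\<Oplus>x\<in>(\<lambda>a. (a, y)) ` A. f x) = (\<Oplus>a\<in>A. f (a, y))"
    using insert by (intro finsum_reindex) (auto simp: inj_on_def)
  also have "(\<Oplus>x\<in>A \<times> B. f x) = (\<Oplus>b\<in>B. \<Oplus>a\<in>A. f (a, b))"
    using insert by auto
  finally show ?case
    using insert by (subst finsum_insert) (auto intro!: finsum_closed)
qed

subsection \<open>Unit groups of monoids\<close>

text \<open>A literal equality of records rather than an isomorphism, so that it serves as a rewrite
  rule. The same holds for the version with powers.\<close>

lemma units_of_DirProd: "units_of (M \<times>\<times> N) = units_of M \<times>\<times> units_of N"
  by (auto simp: units_of_def DirProd_def Units_def)

lemma units_of_group_power: "units_of (group_power M m) = group_power (units_of M) m"
proof -
  have "Units (product_group {..<m} (\<lambda>_. M)) = ({..<m} \<rightarrow>\<^sub>E Units M)"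
  proof (intro equalityI subsetI)
    fix f assume f: "f \<in> {..<m} \<rightarrow>\<^sub>E Units M"
    then have "\<forall>i\<in>{..<m}. \<exists>y. y \<in> carrier M \<and> y \<otimes>\<^bsub>M\<^esub> f i = \<one>\<^bsub>M\<^esub> \<and> f i \<otimes>\<^bsub>M\<^esub> y = \<one>\<^bsub>M\<^esub>"
      by (fastforce simp: Units_def PiE_iff)
    then obtain g where g: "\<forall>i\<in>{..<m}. g i \<in> carrier M \<and> g i \<otimes>\<^bsub>M\<^esub> f i = \<one>\<^bsub>M\<^esub> \<and> f i \<otimes>\<^bsub>M\<^esub> g i = \<one>\<^bsub>M\<^esub>"
      by (auto dest: bchoice)
    show "f \<in> Units (product_group {..<m} (\<lambda>_. M))"
      unfolding Units_def
    \<comment> \<open>Choice leaves \<open>g\<close> arbitrary off \<open>{..<m}\<close>, while the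
      carrier consists of extensional functions; hence the restriction.\<close>
    proof (intro CollectI conjI bexI[of _ "restrict g {..<m}"])
      show "f \<in> carrier (product_group {..<m} (\<lambda>_. M))"
        using f by (auto simp: PiE_iff Units_def)
      show "restrict g {..<m} \<in> carrier (product_group {..<m} (\<lambda>_. M))"
        using g by auto
    qed (use g in \<open>auto intro!: restrict_ext\<close>)
  next
    fix f assume f: "f \<in> Units (product_group {..<m} (\<lambda>_. M))"
    then obtain g where fg: "f \<in> {..<m} \<rightarrow>\<^sub>E carrier M" "g \<in> {..<m} \<rightarrow>\<^sub>E carrier M"
      "(\<lambda>i\<in>{..<m}. g i \<otimes>\<^bsub>M\<^esub> f i) = (\<lambda>i\<in>{..<m}. \<one>\<^bsub>M\<^esub>)"
      "(\<lambda>i\<in>{..<m}. f i \<otimes>\<^bsub>M\<^esub> g i) = (\<lambda>i\<in>{..<m}. \<one>\<^bsub>M\<^esub>)"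
      by (auto simp: Units_def)
    have "g i \<otimes>\<^bsub>M\<^esub> f i = \<one>\<^bsub>M\<^esub>" "f i \<otimes>\<^bsub>M\<^esub> g i = \<one>\<^bsub>M\<^esub>" if "i < m" for i
      using fun_cong[OF fg(3), of i] fun_cong[OF fg(4), of i] that by simp_all
    with fg(1,2) show "f \<in> {..<m} \<rightarrow>\<^sub>E Units M"
      unfolding Units_def PiE_iff by blast
  qed
  then show ?thesis
    by (simp add: group_power_def units_of_def product_group_def)
qed

text \<open>The source is meant to be a group algebra, so closure and the identity are assumed in
  place of the monoid laws: convolution need not be shown associative. Closure allows injectivity of
  \<open>h\<close> to be applied to a product and the identity, which pulls inverses back from
  \<open>N\<close>.\<close>

lemma units_of_iso:
  assumes closed: "\<And>x y. x \<in> carrier M \<Longrightarrow> y \<in> carrier M \<Longrightarrow> x \<otimes>\<^bsub>M\<^esub> y \<in> carrier M" "\<one>\<^bsub>M\<^esub> \<in> carrier M"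
    and hom: "h \<in> hom M N" and one: "h \<one>\<^bsub>M\<^esub> = \<one>\<^bsub>N\<^esub>"
    and bij: "bij_betw h (carrier M) (carrier N)"
  shows "units_of M \<cong> units_of N"
proof -
  have "bij_betw h (Units M) (Units N)"
  proof (rule bij_betwI')
    fix x y assume "x \<in> Units M" "y \<in> Units M"
    then show "(h x = h y) = (x = y)"
      using bij by (auto simp: Units_def bij_betw_def inj_on_def)
  next
    fix x assume "x \<in> Units M"
    then obtain y where "x \<in> carrier M" "y \<in> carrier M" "y \<otimes>\<^bsub>M\<^esub> x = \<one>\<^bsub>M\<^esub>" "x \<otimes>\<^bsub>M\<^esub> y = \<one>\<^bsub>M\<^esub>"
      by (auto simp: Units_def)
    then show "h x \<in> Units N"
      using hom one by (auto simp: Units_def hom_def Pi_iff) metis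
  next
    fix z assume "z \<in> Units N"
    then obtain w where zw: "z \<in> carrier N" "w \<in> carrier N" "w \<otimes>\<^bsub>N\<^esub> z = \<one>\<^bsub>N\<^esub>" "z \<otimes>\<^bsub>N\<^esub> w = \<one>\<^bsub>N\<^esub>"
      by (auto simp: Units_def)
    then obtain x y where xy: "x \<in> carrier M" "y \<in> carrier M" "h x = z" "h y = w"
      using bij_betw_imp_surj_on[OF bij] by (metis imageE)
    have "h (y \<otimes>\<^bsub>M\<^esub> x) = h \<one>\<^bsub>M\<^esub>" "h (x \<otimes>\<^bsub>M\<^esub> y) = h \<one>\<^bsub>M\<^esub>"
      using hom xy zw one by (auto simp: hom_def)
    then have "y \<otimes>\<^bsub>M\<^esub> x = \<one>\<^bsub>M\<^esub>" "x \<otimes>\<^bsub>M\<^esub> y = \<one>\<^bsub>M\<^esub>"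
      using bij_betw_imp_inj_on[OF bij] xy closed
      by (blast dest: inj_onD)+
    with xy show "\<exists>x\<in>Units M. z = h x"
      by (auto simp: Units_def)
  qed
  then have "h \<in> iso (units_of M) (units_of N)"
    using hom bij_betw_imp_funcset[OF \<open>bij_betw h (Units M) (Units N)\<close>]
    by (auto simp: iso_def hom_def units_of_def) (auto simp: Units_def)
  then show ?thesis
    by (auto simp: is_iso_def)
qed

lemma group_power_hom:
  "(\<And>i. i < m \<Longrightarrow> f i \<in> hom M A) \<Longrightarrow> (\<lambda>x. \<lambda>i\<in>{..<m}. f i x) \<in> hom M (group_power A m)"
  by (auto simp: hom_def group_power_def PiE_iff Pi_iff intro!: restrict_ext)

lemma group_power_iso:
  assumes "A \<cong> B"
  shows "group_power A m \<cong> group_power B m"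
proof -
  obtain h where h: "h \<in> iso A B" using assms by (auto simp: is_iso_def)
  have "(\<lambda>x. \<lambda>i\<in>{..<m}. h (x i)) \<in> iso (group_power A m) (group_power B m)"
    unfolding iso_def
  proof (intro CollectI conjI)
    show "(\<lambda>x. \<lambda>i\<in>{..<m}. h (x i)) \<in> hom (group_power A m) (group_power B m)"
      using h by (fastforce simp: hom_def iso_def group_power_def PiE_iff Pi_iff intro!: restrict_ext)
    have hb: "bij_betw h (carrier A) (carrier B)" using h by (auto simp: iso_def)
    show "bij_betw (\<lambda>x. \<lambda>i\<in>{..<m}. h (x i)) (carrier (group_power A m)) (carrier (group_power B m))"
      using bij_betw_imp_funcset[OF hb] bij_betw_imp_funcset[OF bij_betw_inv_into[OF hb]]
      by (intro bij_betw_byWitness[where f' = "\<lambda>y. \<lambda>i\<in>{..<m}. inv_into (carrier A) h (y i)"])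
        (auto simp: group_power_def PiE_iff Pi_iff extensional_def fun_eq_iff
            bij_betw_inv_into_left[OF hb] bij_betw_inv_into_right[OF hb])
  qed
  then show ?thesis by (auto simp: is_iso_def)
qed

subsection \<open>Matrix rings\<close>

lemma matrix_ring_simps [simp]:
  "carrier (matrix_ring n R) = {..<n} \<times> {..<n} \<rightarrow>\<^sub>E carrier R"
  "A \<otimes>\<^bsub>matrix_ring n R\<^esub> B = (\<lambda>(i, j)\<in>{..<n} \<times> {..<n}. \<Oplus>\<^bsub>R\<^esub>l\<in>{..<n}. A (i, l) \<otimes>\<^bsub>R\<^esub> B (l, j))"
  "\<one>\<^bsub>matrix_ring n R\<^esub> = (\<lambda>(i, j)\<in>{..<n} \<times> {..<n}. if i = j then \<one>\<^bsub>R\<^esub> else \<zero>\<^bsub>R\<^esub>)"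
  "\<zero>\<^bsub>matrix_ring n R\<^esub> = (\<lambda>(i, j)\<in>{..<n} \<times> {..<n}. \<zero>\<^bsub>R\<^esub>)"
  "A \<oplus>\<^bsub>matrix_ring n R\<^esub> B = (\<lambda>(i, j)\<in>{..<n} \<times> {..<n}. A (i, j) \<oplus>\<^bsub>R\<^esub> B (i, j))"
  by (simp_all add: matrix_ring_def)

lemma matrix_eqI:
  assumes "A \<in> carrier (matrix_ring n R)" "B \<in> carrier (matrix_ring n R)"
    "\<And>i j. i < n \<Longrightarrow> j < n \<Longrightarrow> A (i, j) = B (i, j)"
  shows "A = B"
  using assms by (intro PiE_ext[of A "{..<n} \<times> {..<n}" "\<lambda>_. carrier R" B]) auto

lemma (in ring) matrix_mult_closed:
  assumes "A \<in> carrier (matrix_ring n R)" "B \<in> carrier (matrix_ring n R)"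
  shows "A \<otimes>\<^bsub>matrix_ring n R\<^esub> B \<in> carrier (matrix_ring n R)"
  using assms by (auto simp: PiE_iff intro!: finsum_closed)

lemma (in ring) matrix_mult_assoc:
  assumes "A \<in> carrier (matrix_ring n R)" "B \<in> carrier (matrix_ring n R)" "C \<in> carrier (matrix_ring n R)"
  shows "A \<otimes>\<^bsub>matrix_ring n R\<^esub> B \<otimes>\<^bsub>matrix_ring n R\<^esub> C = A \<otimes>\<^bsub>matrix_ring n R\<^esub> (B \<otimes>\<^bsub>matrix_ring n R\<^esub> C)"
proof (rule matrix_eqI)
  fix i j assume ij: "i < n" "j < n"
  have [simp]: "\<And>i j. i < n \<Longrightarrow> j < n \<Longrightarrow> A (i, j) \<in> carrier R \<and> B (i, j) \<in> carrier R \<and> C (i, j) \<in> carrier R"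
    using assms by (auto simp: PiE_iff)
  have "(A \<otimes>\<^bsub>matrix_ring n R\<^esub> B \<otimes>\<^bsub>matrix_ring n R\<^esub> C) (i, j)
    = (\<Oplus>l\<in>{..<n}. (\<Oplus>k\<in>{..<n}. A (i, k) \<otimes> B (k, l)) \<otimes> C (l, j))"
    using ij by (simp cong: finsum_cong)
  also have "\<dots> = (\<Oplus>l\<in>{..<n}. \<Oplus>k\<in>{..<n}. A (i, k) \<otimes> (B (k, l) \<otimes> C (l, j)))"
    using ij by (intro finsum_cong') (auto simp: finsum_ldistr m_assoc intro!: finsum_closed finsum_cong')
  also have "\<dots> = (\<Oplus>k\<in>{..<n}. \<Oplus>l\<in>{..<n}. A (i, k) \<otimes> (B (k, l) \<otimes> C (l, j)))"
    using ij by (intro finsum_swap) auto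
  also have "\<dots> = (\<Oplus>k\<in>{..<n}. A (i, k) \<otimes> (\<Oplus>l\<in>{..<n}. B (k, l) \<otimes> C (l, j)))"
    using ij by (intro finsum_cong') (auto simp: finsum_rdistr intro!: finsum_closed)
  also have "\<dots> = (A \<otimes>\<^bsub>matrix_ring n R\<^esub> (B \<otimes>\<^bsub>matrix_ring n R\<^esub> C)) (i, j)"
    using ij by (simp cong: finsum_cong)
  finally show "(A \<otimes>\<^bsub>matrix_ring n R\<^esub> B \<otimes>\<^bsub>matrix_ring n R\<^esub> C) (i, j) = \<dots>" .
qed (use assms in \<open>blast intro: matrix_mult_closed\<close>)+

lemma (in ring) matrix_ring_is_ring: "ring (matrix_ring n R)"
proof (rule ringI)
  show "abelian_group (matrix_ring n R)"
  proof (rule abelian_groupI)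
    fix A assume A: "A \<in> carrier (matrix_ring n R)"
    show "\<exists>B\<in>carrier (matrix_ring n R). B \<oplus>\<^bsub>matrix_ring n R\<^esub> A = \<zero>\<^bsub>matrix_ring n R\<^esub>"
      using A by (intro bexI[of _ "\<lambda>x\<in>{..<n} \<times> {..<n}. \<ominus> A x"]) (auto simp: l_neg PiE_iff intro!: restrict_ext)
  qed (auto simp: PiE_iff extensional_def fun_eq_iff a_assoc intro: a_comm)
  show "monoid (matrix_ring n R)"
  proof (rule monoidI)
    fix A assume A: "A \<in> carrier (matrix_ring n R)"
    have [simp]: "\<And>i j. i < n \<Longrightarrow> j < n \<Longrightarrow> A (i, j) \<in> carrier R" using A by (auto simp: PiE_iff)
    have c: "(\<Oplus>l\<in>{..<n}. (if i = l then \<one> else \<zero>) \<otimes> A (l, j)) = A (i, j)"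
        "(\<Oplus>l\<in>{..<n}. A (i, l) \<otimes> (if l = j then \<one> else \<zero>)) = A (i, j)" if "i < n" "j < n" for i j
    proof -
      have "(\<Oplus>l\<in>{..<n}. (if i = l then \<one> else \<zero>) \<otimes> A (l, j)) = (\<Oplus>l\<in>{..<n}. if i = l then A (l, j) else \<zero>)"
        using that by (intro finsum_cong') auto
      also have "\<dots> = A (i, j)"
        using that by (intro add.finprod_singleton) auto
      finally show "(\<Oplus>l\<in>{..<n}. (if i = l then \<one> else \<zero>) \<otimes> A (l, j)) = A (i, j)" .
      have "(\<Oplus>l\<in>{..<n}. A (i, l) \<otimes> (if l = j then \<one> else \<zero>)) = (\<Oplus>l\<in>{..<n}. if l = j then A (i, l) else \<zero>)"
        using that by (intro finsum_cong') auto
      also have "\<dots> = A (i, j)"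
        using that by (intro add.finprod_singleton_swap) auto
      finally show "(\<Oplus>l\<in>{..<n}. A (i, l) \<otimes> (if l = j then \<one> else \<zero>)) = A (i, j)" .
    qed
    have one: "\<one>\<^bsub>matrix_ring n R\<^esub> \<in> carrier (matrix_ring n R)" by auto
    show "\<one>\<^bsub>matrix_ring n R\<^esub> \<otimes>\<^bsub>matrix_ring n R\<^esub> A = A"
      by (rule matrix_eqI[OF matrix_mult_closed[OF one A] A]) (use c in \<open>simp cong: finsum_cong\<close>)
    show "A \<otimes>\<^bsub>matrix_ring n R\<^esub> \<one>\<^bsub>matrix_ring n R\<^esub> = A"
      by (rule matrix_eqI[OF matrix_mult_closed[OF A one] A]) (use c in \<open>simp cong: finsum_cong\<close>)
  qed ((rule matrix_mult_closed matrix_mult_assoc; assumption) | force)+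
next
  fix A B C assume "A \<in> carrier (matrix_ring n R)" "B \<in> carrier (matrix_ring n R)" "C \<in> carrier (matrix_ring n R)"
  then have [simp]: "\<And>i j. i < n \<Longrightarrow> j < n \<Longrightarrow> A (i, j) \<in> carrier R \<and> B (i, j) \<in> carrier R \<and> C (i, j) \<in> carrier R"
    by (auto simp: PiE_iff)
  show "(A \<oplus>\<^bsub>matrix_ring n R\<^esub> B) \<otimes>\<^bsub>matrix_ring n R\<^esub> C
    = A \<otimes>\<^bsub>matrix_ring n R\<^esub> C \<oplus>\<^bsub>matrix_ring n R\<^esub> B \<otimes>\<^bsub>matrix_ring n R\<^esub> C"
    by (auto simp: l_distr finsum_addf intro!: restrict_ext cong: finsum_cong)
  show "C \<otimes>\<^bsub>matrix_ring n R\<^esub> (A \<oplus>\<^bsub>matrix_ring n R\<^esub> B)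
    = C \<otimes>\<^bsub>matrix_ring n R\<^esub> A \<oplus>\<^bsub>matrix_ring n R\<^esub> C \<otimes>\<^bsub>matrix_ring n R\<^esub> B"
    by (auto simp: r_distr finsum_addf intro!: restrict_ext cong: finsum_cong)
qed

text \<open>Turns a representation applied to a group algebra element into one scalar sum per matrix
  entry.\<close>

lemma (in ring) matrix_finsum_apply:
  assumes "finite T" "\<And>x. x \<in> T \<Longrightarrow> f x \<in> carrier (matrix_ring n R)" "i < n" "j < n"
  shows "(\<Oplus>\<^bsub>matrix_ring n R\<^esub>x\<in>T. f x) (i, j) = (\<Oplus>x\<in>T. f x (i, j))"
  using assms(1,2)
proof (induction T rule: finite_induct)
  interpret M: ring "matrix_ring n R" by (rule matrix_ring_is_ring)
  case empty
  then show ?case using assms by (simp del: matrix_ring_simps) simp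
next
  interpret M: ring "matrix_ring n R" by (rule matrix_ring_is_ring)
  case (insert x T)
  have "(\<Oplus>\<^bsub>matrix_ring n R\<^esub>x\<in>insert x T. f x) (i, j) = (f x \<oplus>\<^bsub>matrix_ring n R\<^esub> (\<Oplus>\<^bsub>matrix_ring n R\<^esub>x\<in>T. f x)) (i, j)"
    using insert by (subst M.finsum_insert) (auto simp del: matrix_ring_simps)
  also have "\<dots> = f x (i, j) \<oplus> (\<Oplus>x\<in>T. f x (i, j))"
    using insert assms by simp
  also have "\<dots> = (\<Oplus>x\<in>insert x T. f x (i, j))"
    using insert assms by (subst finsum_insert) (auto simp: PiE_iff)
  finally show ?case .
qed

subsection \<open>Group algebras\<close>

lemma group_algebra_simps [simp]:
  "carrier (group_algebra R G) = carrier G \<rightarrow>\<^sub>E carrier R"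
  "f \<otimes>\<^bsub>group_algebra R G\<^esub> g = (\<lambda>x\<in>carrier G.
     \<Oplus>\<^bsub>R\<^esub>y\<in>carrier G. f y \<otimes>\<^bsub>R\<^esub> g (inv\<^bsub>G\<^esub> y \<otimes>\<^bsub>G\<^esub> x))"
  "\<one>\<^bsub>group_algebra R G\<^esub> = (\<lambda>x\<in>carrier G. if x = \<one>\<^bsub>G\<^esub> then \<one>\<^bsub>R\<^esub> else \<zero>\<^bsub>R\<^esub>)"
  by (simp_all add: group_algebra_def)

lemma group_algebra_closed:
  assumes "group G" "ring R"
  shows "\<lbrakk>f \<in> carrier (group_algebra R G); g \<in> carrier (group_algebra R G)\<rbrakk>
      \<Longrightarrow> f \<otimes>\<^bsub>group_algebra R G\<^esub> g \<in> carrier (group_algebra R G)"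
    and "\<one>\<^bsub>group_algebra R G\<^esub> \<in> carrier (group_algebra R G)"
proof -
  interpret G: group G by fact
  interpret R: ring R by fact
  show "\<lbrakk>f \<in> carrier (group_algebra R G); g \<in> carrier (group_algebra R G)\<rbrakk>
      \<Longrightarrow> f \<otimes>\<^bsub>group_algebra R G\<^esub> g \<in> carrier (group_algebra R G)"
    by (auto simp: PiE_iff intro!: R.finsum_closed)
  show "\<one>\<^bsub>group_algebra R G\<^esub> \<in> carrier (group_algebra R G)" by auto
qed

lemma (in ring_hom_ring) hom_finsum':
  "(\<And>i. i \<in> A \<Longrightarrow> f i \<in> carrier R) \<Longrightarrow> h (\<Oplus>i\<in>A. f i) = (\<Oplus>\<^bsub>S\<^esub>i\<in>A. h (f i))"
  using hom_finsum[of f A] by (auto simp: o_def)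

text \<open>The linear extension of \<open>g\<close> to the group algebra. The coefficients pass
  through \<open>h\<close> because they may live in a smaller ring than the values: \<open>h\<close>
  is the identity, an embedding of fields, or such a map followed by the scalar matrices.\<close>

definition extend_hom ::
    "('g, 'n) monoid_scheme \<Rightarrow> ('b, 'k) ring_scheme \<Rightarrow> ('a \<Rightarrow> 'b) \<Rightarrow> ('g \<Rightarrow> 'b) \<Rightarrow> ('g \<Rightarrow> 'a) \<Rightarrow> 'b" where
  "extend_hom G S h g f = (\<Oplus>\<^bsub>S\<^esub>x\<in>carrier G. h (f x) \<otimes>\<^bsub>S\<^esub> g x)"

text \<open>\<open>S\<close> may be a matrix ring, so \<open>comm\<close> asks that coefficients
  commute with the values of \<open>g\<close>; scalar matrices do. Multiplicativity is the
  substitution of \<open>y x\<close> for \<open>x\<close> in the double sum defining the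
  convolution.\<close>

lemma extend_hom:
  assumes "group G" and fin: "finite (carrier G)" and "ring R" "ring S"
    and h: "h \<in> ring_hom R S" and g: "g \<in> hom G S" and g1: "g \<one>\<^bsub>G\<^esub> = \<one>\<^bsub>S\<^esub>"
    and comm: "\<And>a x. a \<in> carrier R \<Longrightarrow> x \<in> carrier G \<Longrightarrow> h a \<otimes>\<^bsub>S\<^esub> g x = g x \<otimes>\<^bsub>S\<^esub> h a"
  shows "extend_hom G S h g \<in> hom (group_algebra R G) S"
    and "extend_hom G S h g \<one>\<^bsub>group_algebra R G\<^esub> = \<one>\<^bsub>S\<^esub>"
proof -
  interpret G: group G by fact
  interpret R: ring R by fact
  interpret S: ring S by fact
  interpret h: ring_hom_ring R S h
    using h by (simp add: ring_hom_ringI2 R.ring_axioms S.ring_axioms)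
  have gc [simp]: "g x \<in> carrier S" if "x \<in> carrier G" for x
    using g that by (auto simp: hom_def)
  have gm: "g (x \<otimes>\<^bsub>G\<^esub> y) = g x \<otimes>\<^bsub>S\<^esub> g y" if "x \<in> carrier G" "y \<in> carrier G" for x y
    using g that by (auto simp: hom_def)
  show "extend_hom G S h g \<in> hom (group_algebra R G) S"
  proof (rule homI)
    fix f assume "f \<in> carrier (group_algebra R G)"
    then show "extend_hom G S h g f \<in> carrier S"
      by (auto simp: extend_hom_def PiE_iff intro!: S.finsum_closed)
  next
    fix f f' assume "f \<in> carrier (group_algebra R G)" "f' \<in> carrier (group_algebra R G)"
    then have [simp]: "f x \<in> carrier R" "f' x \<in> carrier R" if "x \<in> carrier G" for x
      using that by (auto simp: PiE_iff)
    have "extend_hom G S h g (f \<otimes>\<^bsub>group_algebra R G\<^esub> f') =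
        (\<Oplus>\<^bsub>S\<^esub>x\<in>carrier G. \<Oplus>\<^bsub>S\<^esub>y\<in>carrier G. h (f y) \<otimes>\<^bsub>S\<^esub> h (f' (inv\<^bsub>G\<^esub> y \<otimes>\<^bsub>G\<^esub> x)) \<otimes>\<^bsub>S\<^esub> g x)"
      unfolding extend_hom_def
      using fin by (intro S.finsum_cong')
        (auto simp: h.hom_finsum' S.finsum_ldistr intro!: S.finsum_closed S.finsum_cong')
    also have "\<dots> = (\<Oplus>\<^bsub>S\<^esub>y\<in>carrier G. \<Oplus>\<^bsub>S\<^esub>x\<in>carrier G. h (f y) \<otimes>\<^bsub>S\<^esub> h (f' (inv\<^bsub>G\<^esub> y \<otimes>\<^bsub>G\<^esub> x)) \<otimes>\<^bsub>S\<^esub> g x)"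
      using fin by (intro S.finsum_swap) auto
    also have "\<dots> = (\<Oplus>\<^bsub>S\<^esub>y\<in>carrier G. h (f y) \<otimes>\<^bsub>S\<^esub> g y \<otimes>\<^bsub>S\<^esub> extend_hom G S h g f')"
    proof (rule S.finsum_cong')
      \<comment> \<open>Left translation by \<open>y\<close> permutes the group; after reindexing,
        the argument of \<open>f'\<close> is \<open>x\<close> alone.\<close>
      fix y assume y: "y \<in> carrier G"
      have "(\<Oplus>\<^bsub>S\<^esub>x\<in>carrier G. h (f y) \<otimes>\<^bsub>S\<^esub> h (f' (inv\<^bsub>G\<^esub> y \<otimes>\<^bsub>G\<^esub> x)) \<otimes>\<^bsub>S\<^esub> g x)
          = (\<Oplus>\<^bsub>S\<^esub>x\<in>(\<lambda>x. y \<otimes>\<^bsub>G\<^esub> x) ` carrier G. h (f y) \<otimes>\<^bsub>S\<^esub> h (f' (inv\<^bsub>G\<^esub> y \<otimes>\<^bsub>G\<^esub> x)) \<otimes>\<^bsub>S\<^esub> g x)"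
        using y by (simp add: G.surj_const_mult)
      also have "\<dots> = (\<Oplus>\<^bsub>S\<^esub>x\<in>carrier G. h (f y) \<otimes>\<^bsub>S\<^esub> h (f' (inv\<^bsub>G\<^esub> y \<otimes>\<^bsub>G\<^esub> (y \<otimes>\<^bsub>G\<^esub> x))) \<otimes>\<^bsub>S\<^esub> g (y \<otimes>\<^bsub>G\<^esub> x))"
        using y by (intro S.finsum_reindex) (auto simp: G.inj_on_cmult)
      also have "\<dots> = (\<Oplus>\<^bsub>S\<^esub>x\<in>carrier G. (h (f y) \<otimes>\<^bsub>S\<^esub> g y) \<otimes>\<^bsub>S\<^esub> (h (f' x) \<otimes>\<^bsub>S\<^esub> g x))"
      proof (rule S.finsum_cong')
        \<comment> \<open>This is where \<open>comm\<close> acts: \<open>g y\<close> moves to the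
          left past \<open>h (f' x)\<close>.\<close>
        fix x assume x: "x \<in> carrier G"
        have "h (f y) \<otimes>\<^bsub>S\<^esub> h (f' x) \<otimes>\<^bsub>S\<^esub> (g y \<otimes>\<^bsub>S\<^esub> g x) = h (f y) \<otimes>\<^bsub>S\<^esub> (h (f' x) \<otimes>\<^bsub>S\<^esub> g y) \<otimes>\<^bsub>S\<^esub> g x"
          using x y by (simp add: S.m_assoc)
        also have "\<dots> = h (f y) \<otimes>\<^bsub>S\<^esub> g y \<otimes>\<^bsub>S\<^esub> (h (f' x) \<otimes>\<^bsub>S\<^esub> g x)"
          using x y by (simp add: S.m_assoc comm[of "f' x" y])
        finally show "h (f y) \<otimes>\<^bsub>S\<^esub> h (f' (inv\<^bsub>G\<^esub> y \<otimes>\<^bsub>G\<^esub> (y \<otimes>\<^bsub>G\<^esub> x))) \<otimes>\<^bsub>S\<^esub> g (y \<otimes>\<^bsub>G\<^esub> x)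
            = h (f y) \<otimes>\<^bsub>S\<^esub> g y \<otimes>\<^bsub>S\<^esub> (h (f' x) \<otimes>\<^bsub>S\<^esub> g x)"
          using x y by (simp add: gm flip: G.m_assoc)
      qed (use y in auto)
      also have "\<dots> = h (f y) \<otimes>\<^bsub>S\<^esub> g y \<otimes>\<^bsub>S\<^esub> extend_hom G S h g f'"
        unfolding extend_hom_def using y fin by (subst S.finsum_rdistr) auto
      finally show "(\<Oplus>\<^bsub>S\<^esub>x\<in>carrier G. h (f y) \<otimes>\<^bsub>S\<^esub> h (f' (inv\<^bsub>G\<^esub> y \<otimes>\<^bsub>G\<^esub> x)) \<otimes>\<^bsub>S\<^esub> g x)
          = h (f y) \<otimes>\<^bsub>S\<^esub> g y \<otimes>\<^bsub>S\<^esub> extend_hom G S h g f'" .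
    qed (auto simp: extend_hom_def intro!: S.finsum_closed)
    also have "\<dots> = extend_hom G S h g f \<otimes>\<^bsub>S\<^esub> extend_hom G S h g f'"
      unfolding extend_hom_def[of G S h g f] using fin
      by (subst S.finsum_ldistr) (auto simp: extend_hom_def intro!: S.finsum_closed)
    finally show "extend_hom G S h g (f \<otimes>\<^bsub>group_algebra R G\<^esub> f')
        = extend_hom G S h g f \<otimes>\<^bsub>S\<^esub> extend_hom G S h g f'" .
  qed
  have "extend_hom G S h g \<one>\<^bsub>group_algebra R G\<^esub> = (\<Oplus>\<^bsub>S\<^esub>x\<in>carrier G. if \<one>\<^bsub>G\<^esub> = x then g x else \<zero>\<^bsub>S\<^esub>)"
    unfolding extend_hom_def by (intro S.finsum_cong') auto
  also have "\<dots> = \<one>\<^bsub>S\<^esub>"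
    using fin g1 by (subst S.add.finprod_singleton) auto
  finally show "extend_hom G S h g \<one>\<^bsub>group_algebra R G\<^esub> = \<one>\<^bsub>S\<^esub>" .
qed

text \<open>Commuting images allow the two middle factors \<open>v b\<close> and \<open>u a'\<close>
  to be exchanged. Applied with \<open>u\<close> given by powers of a fourth root of unity and
  \<open>v\<close> by a sign character or the dihedral representation.\<close>

lemma hom_mult_commuting:
  assumes "monoid S" "u \<in> hom A S" "v \<in> hom B S"
    and "\<And>a b. a \<in> carrier A \<Longrightarrow> b \<in> carrier B \<Longrightarrow> u a \<otimes>\<^bsub>S\<^esub> v b = v b \<otimes>\<^bsub>S\<^esub> u a"
  shows "(\<lambda>(a, b). u a \<otimes>\<^bsub>S\<^esub> v b) \<in> hom (A \<times>\<times> B) S"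
proof -
  interpret S: monoid S by fact
  have [simp]: "u a \<in> carrier S" if "a \<in> carrier A" for a using assms(2) that by (auto simp: hom_def)
  have [simp]: "v b \<in> carrier S" if "b \<in> carrier B" for b using assms(3) that by (auto simp: hom_def)
  have "u (a \<otimes>\<^bsub>A\<^esub> a') \<otimes>\<^bsub>S\<^esub> v (b \<otimes>\<^bsub>B\<^esub> b') = u a \<otimes>\<^bsub>S\<^esub> v b \<otimes>\<^bsub>S\<^esub> (u a' \<otimes>\<^bsub>S\<^esub> v b')"
    if "a \<in> carrier A" "a' \<in> carrier A" "b \<in> carrier B" "b' \<in> carrier B" for a a' b b'
  proof -
    have "u (a \<otimes>\<^bsub>A\<^esub> a') \<otimes>\<^bsub>S\<^esub> v (b \<otimes>\<^bsub>B\<^esub> b') = u a \<otimes>\<^bsub>S\<^esub> (u a' \<otimes>\<^bsub>S\<^esub> v b) \<otimes>\<^bsub>S\<^esub> v b'"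
      using that assms(2,3) by (simp add: hom_def S.m_assoc)
    also have "\<dots> = u a \<otimes>\<^bsub>S\<^esub> v b \<otimes>\<^bsub>S\<^esub> (u a' \<otimes>\<^bsub>S\<^esub> v b')"
      using that by (simp add: S.m_assoc assms(4)[of a' b])
    finally show ?thesis .
  qed
  then show ?thesis
    by (auto simp: hom_def)
qed

subsection \<open>Representations of cyclic and dihedral groups\<close>

lemma (in monoid) nat_pow_mod:
  assumes "z \<in> carrier G" "z [^] n = \<one>"
  shows "z [^] (m mod n) = z [^] (m :: nat)"
proof -
  have "z [^] (n * d + r) = z [^] r" for d r
    using assms by (simp add: nat_pow_mult[symmetric] nat_pow_pow[symmetric])
  from this[of "m div n" "m mod n"] show ?thesis by simp
qed

text \<open>\<open>integer_mod_group 0\<close> is the group of all integers, on which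
  \<open>nat\<close> truncates; \<open>n > 0\<close> makes all representatives non-negative.\<close>

lemma (in monoid) integer_mod_group_hom:
  assumes "z \<in> carrier G" "z [^] n = \<one>" "n > 0"
  shows "(\<lambda>i. z [^] nat i) \<in> hom (integer_mod_group n) G"
proof (rule homI)
  fix i j assume "i \<in> carrier (integer_mod_group n)" "j \<in> carrier (integer_mod_group n)"
  then have ij: "i \<ge> 0" "j \<ge> 0" using assms(3) by (auto simp: carrier_integer_mod_group)
  then have "nat ((i + j) mod int n) = (nat i + nat j) mod n"
    by (simp add: nat_mod_distrib nat_add_distrib)
  then show "z [^] nat (i \<otimes>\<^bsub>integer_mod_group n\<^esub> j) = z [^] nat i \<otimes> z [^] nat j"
    using assms by (simp add: nat_pow_mod nat_pow_mult)
qed (use assms in auto)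

lemma dihedral_group_simps [simp]:
  "carrier (dihedral_group m) = {0..<int (m div 2)} \<times> UNIV"
  "(i, a) \<otimes>\<^bsub>dihedral_group m\<^esub> (j, b) = ((if a then i - j else i + j) mod int (m div 2), a \<noteq> b)"
  "\<one>\<^bsub>dihedral_group m\<^esub> = (0, False)"
  by (simp_all add: dihedral_group_def)

lemma dihedral_group_is_group:
  assumes "m > 1"
  shows "group (dihedral_group m)"
proof (rule groupI)
  fix x y z
  assume "x \<in> carrier (dihedral_group m)" "y \<in> carrier (dihedral_group m)" "z \<in> carrier (dihedral_group m)"
  then show "x \<otimes>\<^bsub>dihedral_group m\<^esub> y \<otimes>\<^bsub>dihedral_group m\<^esub> z = x \<otimes>\<^bsub>dihedral_group m\<^esub> (y \<otimes>\<^bsub>dihedral_group m\<^esub> z)"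
    by (cases x; cases y; cases z) (auto simp: mod_simps algebra_simps)
next
  fix x assume x: "x \<in> carrier (dihedral_group m)"
  obtain i a where xe: "x = (i, a)" by (cases x)
  show "\<exists>y\<in>carrier (dihedral_group m). y \<otimes>\<^bsub>dihedral_group m\<^esub> x = \<one>\<^bsub>dihedral_group m\<^esub>"
    \<comment> \<open>A reflection is its own inverse.\<close>
    using x assms unfolding xe
    by (intro bexI[of _ "(if a then i else (- i) mod int (m div 2), a)"]) (auto simp: mod_simps)
next
  fix x assume x: "x \<in> carrier (dihedral_group m)"
  then show "\<one>\<^bsub>dihedral_group m\<^esub> \<otimes>\<^bsub>dihedral_group m\<^esub> x = x"
    by (cases x) auto
qed (use assms in auto)

definition mat2 :: "'a \<Rightarrow> 'a \<Rightarrow> 'a \<Rightarrow> 'a \<Rightarrow> nat \<times> nat \<Rightarrow> 'a" where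
  "mat2 a b c d = (\<lambda>(i, j)\<in>{..<2} \<times> {..<2}.
     if i = 0 then (if j = 0 then a else b) else (if j = 0 then c else d))"

lemma mat2_simps [simp]:
  "mat2 a b c d (0, 0) = a" "mat2 a b c d (0, Suc 0) = b"
  "mat2 a b c d (Suc 0, 0) = c" "mat2 a b c d (Suc 0, Suc 0) = d"
  by (simp_all add: mat2_def)

lemma mat2_eqI:
  assumes "A \<in> carrier (matrix_ring 2 R)" "B \<in> carrier (matrix_ring 2 R)"
    "A (0, 0) = B (0, 0)" "A (0, Suc 0) = B (0, Suc 0)"
    "A (Suc 0, 0) = B (Suc 0, 0)" "A (Suc 0, Suc 0) = B (Suc 0, Suc 0)"
  shows "A = B"
  using assms(3-6) by (intro matrix_eqI[OF assms(1,2)]) (auto simp: less_2_cases_iff)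

lemma mat2_closed [simp]:
  "\<lbrakk>a \<in> carrier R; b \<in> carrier R; c \<in> carrier R; d \<in> carrier R\<rbrakk> \<Longrightarrow> mat2 a b c d \<in> carrier (matrix_ring 2 R)"
  by (auto simp: mat2_def)

lemma mat2_cases:
  assumes "A \<in> carrier (matrix_ring 2 R)"
  obtains a b c d where "a \<in> carrier R" "b \<in> carrier R" "c \<in> carrier R" "d \<in> carrier R" "A = mat2 a b c d"
proof
  show c: "A (0, 0) \<in> carrier R" "A (0, Suc 0) \<in> carrier R" "A (Suc 0, 0) \<in> carrier R" "A (Suc 0, Suc 0) \<in> carrier R"
    using assms by (auto simp: PiE_iff)
  show "A = mat2 (A (0, 0)) (A (0, Suc 0)) (A (Suc 0, 0)) (A (Suc 0, Suc 0))"
    using assms c by (intro mat2_eqI[of _ R]) (simp_all del: matrix_ring_simps)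
qed

lemma (in ring) mat2_mult [simp]:
  assumes [simp]: "a \<in> carrier R" "b \<in> carrier R" "c \<in> carrier R" "d \<in> carrier R"
    "a' \<in> carrier R" "b' \<in> carrier R" "c' \<in> carrier R" "d' \<in> carrier R"
  shows "mat2 a b c d \<otimes>\<^bsub>matrix_ring 2 R\<^esub> mat2 a' b' c' d' =
    mat2 (a \<otimes> a' \<oplus> b \<otimes> c') (a \<otimes> b' \<oplus> b \<otimes> d') (c \<otimes> a' \<oplus> d \<otimes> c') (c \<otimes> b' \<oplus> d \<otimes> d')"
proof -
  have 2: "{..<2::nat} = {0, Suc 0}" by auto
  show ?thesis
    by (rule mat2_eqI[of _ R]) (simp_all add: matrix_mult_closed del: matrix_ring_simps(1,2), simp_all add: 2 a_comm)
qed

lemma mat2_add [simp]: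
  "mat2 a b c d \<oplus>\<^bsub>matrix_ring 2 R\<^esub> mat2 a' b' c' d' = 
    mat2 (a \<oplus>\<^bsub>R\<^esub> a') (b \<oplus>\<^bsub>R\<^esub> b') (c \<oplus>\<^bsub>R\<^esub> c') (d \<oplus>\<^bsub>R\<^esub> d')"
  by (auto simp: mat2_def fun_eq_iff)

lemma one_mat2: "\<one>\<^bsub>matrix_ring 2 R\<^esub> = mat2 \<one>\<^bsub>R\<^esub> \<zero>\<^bsub>R\<^esub> \<zero>\<^bsub>R\<^esub> \<one>\<^bsub>R\<^esub>"
  by (auto simp: mat2_def fun_eq_iff less_2_cases_iff)

definition scalar_mat :: "('b, 'k) ring_scheme \<Rightarrow> 'b \<Rightarrow> nat \<times> nat \<Rightarrow> 'b" where
  "scalar_mat R c = mat2 c \<zero>\<^bsub>R\<^esub> \<zero>\<^bsub>R\<^esub> c"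

lemma (in ring) scalar_mat_hom: "scalar_mat R \<in> ring_hom R (matrix_ring 2 R)"
  by (rule ring_hom_memI)
    (simp_all add: scalar_mat_def one_mat2 del: matrix_ring_simps)

lemma (in cring) scalar_mat_commute:
  assumes "c \<in> carrier R" "A \<in> carrier (matrix_ring 2 R)"
  shows "scalar_mat R c \<otimes>\<^bsub>matrix_ring 2 R\<^esub> A = A \<otimes>\<^bsub>matrix_ring 2 R\<^esub> scalar_mat R c"
  using assms(1)
  by (cases rule: mat2_cases[OF assms(2)])
    (simp add: scalar_mat_def m_comm del: matrix_ring_simps)

lemma (in ring) scalar_mat_mult_apply:
  assumes "c \<in> carrier R" "A \<in> carrier (matrix_ring 2 R)" "i < 2" "j < 2"
  shows "(scalar_mat R c \<otimes>\<^bsub>matrix_ring 2 R\<^esub> A) (i, j) = c \<otimes> A (i, j)"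
  using assms(1,3,4)
  by (cases rule: mat2_cases[OF assms(2)])
    (auto simp add: scalar_mat_def less_2_cases_iff simp del: matrix_ring_simps)

text \<open>The rotation \<open>r\<close> cyclically permutes \<open>e\<^sub>1, e\<^sub>2, - e\<^sub>1 - e\<^sub>2\<close>, and \<open>s\<close> swaps
  \<open>e\<^sub>1, e\<^sub>2\<close>.\<close>

definition dihedral_rep :: "('b, 'k) ring_scheme \<Rightarrow> int \<times> bool \<Rightarrow> nat \<times> nat \<Rightarrow> 'b" where
  "dihedral_rep R = (\<lambda>(i, b).
     if b then
       (if i = 0 then mat2 \<zero>\<^bsub>R\<^esub> \<one>\<^bsub>R\<^esub> \<one>\<^bsub>R\<^esub> \<zero>\<^bsub>R\<^esub>
        else if i = 1 then mat2 (\<ominus>\<^bsub>R\<^esub> \<one>\<^bsub>R\<^esub>) \<zero>\<^bsub>R\<^esub> (\<ominus>\<^bsub>R\<^esub> \<one>\<^bsub>R\<^esub>) \<one>\<^bsub>R\<^esub>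
        else mat2 \<one>\<^bsub>R\<^esub> (\<ominus>\<^bsub>R\<^esub> \<one>\<^bsub>R\<^esub>) \<zero>\<^bsub>R\<^esub> (\<ominus>\<^bsub>R\<^esub> \<one>\<^bsub>R\<^esub>))
     else
       (if i = 0 then mat2 \<one>\<^bsub>R\<^esub> \<zero>\<^bsub>R\<^esub> \<zero>\<^bsub>R\<^esub> \<one>\<^bsub>R\<^esub>
        else if i = 1 then mat2 \<zero>\<^bsub>R\<^esub> (\<ominus>\<^bsub>R\<^esub> \<one>\<^bsub>R\<^esub>) \<one>\<^bsub>R\<^esub> (\<ominus>\<^bsub>R\<^esub> \<one>\<^bsub>R\<^esub>)
        else mat2 (\<ominus>\<^bsub>R\<^esub> \<one>\<^bsub>R\<^esub>) \<one>\<^bsub>R\<^esub> (\<ominus>\<^bsub>R\<^esub> \<one>\<^bsub>R\<^esub>) \<zero>\<^bsub>R\<^esub>))"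

lemma carrier_dihedral_group_6: "carrier (dihedral_group 6) = {0, 1, 2} \<times> UNIV"
  by (auto simp: set_eq_iff)

lemma (in ring) dihedral_rep_hom: "dihedral_rep R \<in> hom (dihedral_group 6) (matrix_ring 2 R)"
proof (rule homI)
  fix x assume "x \<in> carrier (dihedral_group 6)"
  then show "dihedral_rep R x \<in> carrier (matrix_ring 2 R)"
    unfolding carrier_dihedral_group_6 by (auto simp: dihedral_rep_def simp del: matrix_ring_simps)
next
  fix x y assume "x \<in> carrier (dihedral_group 6)" "y \<in> carrier (dihedral_group 6)"
  then show "dihedral_rep R (x \<otimes>\<^bsub>dihedral_group 6\<^esub> y) = dihedral_rep R x \<otimes>\<^bsub>matrix_ring 2 R\<^esub> dihedral_rep R y"
    unfolding carrier_dihedral_group_6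
    by (cases x; cases y; cases "snd x"; cases "snd y")
      (auto simp: dihedral_rep_def l_minus r_minus l_neg r_neg simp del: matrix_ring_simps)
qed

text \<open>Linear characters of \<open>D_6\<close> kill the rotations, which are commutators. With
  \<open>e = 1\<close> this is the trivial character, with \<open>e = -1\<close> the sign
  character.\<close>

lemma (in ring) sign_hom:
  assumes "e \<in> carrier R" "e \<otimes> e = \<one>"
  shows "(\<lambda>x. if snd x then e else \<one>) \<in> hom (dihedral_group m) R"
  using assms by (auto simp: hom_def)

text \<open>Rotations come before reflections; the inversion lemma for the dihedral transform lists
  its variables in this order.\<close>

lemma (in abelian_group) finsum_dihedral_group_6:
  assumes "\<And>x. x \<in> carrier (dihedral_group 6) \<Longrightarrow> f x \<in> carrier G"
  shows "(\<Oplus>x\<in>carrier (dihedral_group 6). f x) =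
    f (0, False) \<oplus> f (1, False) \<oplus> f (2, False) \<oplus> f (0, True) \<oplus> f (1, True) \<oplus> f (2, True)"
proof -
  have eq: "carrier (dihedral_group 6) = {(0, False), (1, False), (2, False), (0, True), (1, True), (2, True)}"
    by (auto simp: carrier_dihedral_group_6)
  show ?thesis
    using assms unfolding eq by (simp add: a_ac)
qed

lemma carrier_integer_mod_group_4: "carrier (integer_mod_group 4) = {0, 1, 2, 3}"
  by (auto simp: carrier_integer_mod_group)

lemma (in abelian_group) finsum_cyclic_4:
  assumes "\<And>i. i \<in> carrier (integer_mod_group 4) \<Longrightarrow> f i \<in> carrier G"
  shows "(\<Oplus>i\<in>carrier (integer_mod_group 4). f i) = f 0 \<oplus> f 1 \<oplus> f 2 \<oplus> f 3"
  using assms unfolding carrier_integer_mod_group_4 by (simp add: a_ac)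

subsection \<open>Fourier analysis on \<open>C\<^sub>4 \<times> D\<^sub>6\<close>\<close>

definition c4d6 :: "(int \<times> int \<times> bool) monoid" where
  "c4d6 = integer_mod_group 4 \<times>\<times> dihedral_group 6"

lemma c4d6_carrier: "carrier c4d6 = carrier (integer_mod_group 4) \<times> carrier (dihedral_group 6)"
  by (simp add: c4d6_def)

lemma c4d6_group: "group c4d6"
  unfolding c4d6_def by (intro DirProd_group group_integer_mod_group dihedral_group_is_group) simp

lemma finite_C4: "finite (carrier (integer_mod_group 4))"
  by (simp add: carrier_integer_mod_group)

lemma finite_c4d6: "finite (carrier c4d6)"
  by (simp add: c4d6_carrier carrier_integer_mod_group)

lemma card_c4d6: "card (carrier c4d6) = 24"
  by (simp add: c4d6_carrier carrier_integer_mod_group card_cartesian_product)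

text \<open>The linear character sending a generator of \<open>C_4\<close> to \<open>z\<close> and
  every reflection to \<open>e\<close>, extended linearly.\<close>

definition c4d6_char ::
    "('b, 'k) ring_scheme \<Rightarrow> ('a \<Rightarrow> 'b) \<Rightarrow> 'b \<Rightarrow> 'b \<Rightarrow> (int \<times> int \<times> bool \<Rightarrow> 'a) \<Rightarrow> 'b" where
  "c4d6_char S h z e = extend_hom c4d6 S h
     (\<lambda>(i, x). z [^]\<^bsub>S\<^esub> nat i \<otimes>\<^bsub>S\<^esub> (if snd x then e else \<one>\<^bsub>S\<^esub>))"

text \<open>The tensor product of the character \<open>z\<close> of \<open>C_4\<close> with the
  two-dimensional representation of \<open>D_6\<close>, extended linearly; the one-dimensional
  factor acts by scalar matrices.\<close>

definition c4d6_rep ::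
    "('b, 'k) ring_scheme \<Rightarrow> ('a \<Rightarrow> 'b) \<Rightarrow> 'b \<Rightarrow> (int \<times> int \<times> bool \<Rightarrow> 'a) \<Rightarrow> nat \<times> nat \<Rightarrow> 'b" where
  "c4d6_rep S h z = extend_hom c4d6 (matrix_ring 2 S) (scalar_mat S \<circ> h)
     (\<lambda>(i, x). scalar_mat S (z [^]\<^bsub>S\<^esub> nat i) \<otimes>\<^bsub>matrix_ring 2 S\<^esub> dihedral_rep S x)"

text \<open>The partial transform in the cyclic variable: for fixed \<open>x\<close> the values
  \<open>f (i, x)\<close> are the coefficients of a polynomial of degree at most 3, evaluated here
  at \<open>z\<close>. It links the two stages of the inversion.\<close>

definition c4_eval ::
    "('b, 'k) ring_scheme \<Rightarrow> ('a \<Rightarrow> 'b) \<Rightarrow> 'b \<Rightarrow> (int \<times> int \<times> bool \<Rightarrow> 'a) \<Rightarrow> int \<times> bool \<Rightarrow> 'b" where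
  "c4_eval S h z f x = (\<Oplus>\<^bsub>S\<^esub>i\<in>carrier (integer_mod_group 4). h (f (i, x)) \<otimes>\<^bsub>S\<^esub> z [^]\<^bsub>S\<^esub> nat i)"

text \<open>The root \<open>z\<close> need not be primitive, so 1, -1 and the square roots of -1 are
  treated alike.\<close>

locale root_eval = F: cring F + S: cring S
  for F :: "('a, 'm) ring_scheme" and S :: "('b, 'n) ring_scheme" +
  fixes h z
  assumes hom: "h \<in> ring_hom F S" and z [simp]: "z \<in> carrier S" and z4: "z [^]\<^bsub>S\<^esub> (4::nat) = \<one>\<^bsub>S\<^esub>"
begin

lemma h_closed [simp]: "a \<in> carrier F \<Longrightarrow> h a \<in> carrier S"
  using hom by (simp add: ring_hom_closed)

lemma c4d6_char_hom:
  assumes e: "e \<in> carrier S" "e \<otimes>\<^bsub>S\<^esub> e = \<one>\<^bsub>S\<^esub>"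
  shows "c4d6_char S h z e \<in> hom (group_algebra F c4d6) S"
    and "c4d6_char S h z e \<one>\<^bsub>group_algebra F c4d6\<^esub> = \<one>\<^bsub>S\<^esub>"
proof -
  have g: "(\<lambda>(i, x). z [^]\<^bsub>S\<^esub> nat i \<otimes>\<^bsub>S\<^esub> (if snd x then e else \<one>\<^bsub>S\<^esub>)) \<in> hom c4d6 S"
    unfolding c4d6_def
    using e by (intro hom_mult_commuting S.integer_mod_group_hom S.sign_hom S.monoid_axioms z4 z)
      (auto simp: S.m_comm)
  show "c4d6_char S h z e \<in> hom (group_algebra F c4d6) S"
    and "c4d6_char S h z e \<one>\<^bsub>group_algebra F c4d6\<^esub> = \<one>\<^bsub>S\<^esub>"
    unfolding c4d6_char_def
    by (intro extend_hom c4d6_group finite_c4d6 F.ring_axioms S.ring_axioms hom g;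
        use hom_in_carrier[OF g] in \<open>auto simp: c4d6_def S.m_comm\<close>)+
qed

lemma c4d6_rep_hom:
  shows "c4d6_rep S h z \<in> hom (group_algebra F c4d6) (matrix_ring 2 S)"
    and "c4d6_rep S h z \<one>\<^bsub>group_algebra F c4d6\<^esub> = \<one>\<^bsub>matrix_ring 2 S\<^esub>"
proof -
  interpret M: ring "matrix_ring 2 S" by (rule S.matrix_ring_is_ring)
  have "scalar_mat S \<in> hom S (matrix_ring 2 S)"
    using S.scalar_mat_hom by (auto simp: ring_hom_def hom_def)
  then have "scalar_mat S \<circ> (\<lambda>i. z [^]\<^bsub>S\<^esub> nat i) \<in> hom (integer_mod_group 4) (matrix_ring 2 S)"
    by (intro hom_compose[OF S.integer_mod_group_hom]) (simp_all add: z4)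
  then have g: "(\<lambda>(i, x). scalar_mat S (z [^]\<^bsub>S\<^esub> nat i) \<otimes>\<^bsub>matrix_ring 2 S\<^esub> dihedral_rep S x)
      \<in> hom c4d6 (matrix_ring 2 S)"
    unfolding c4d6_def using hom_in_carrier[OF S.dihedral_rep_hom]
    by (intro hom_mult_commuting S.dihedral_rep_hom M.monoid_axioms)
      (auto simp: S.scalar_mat_commute o_def simp del: matrix_ring_simps)
  have h': "scalar_mat S \<circ> h \<in> ring_hom F (matrix_ring 2 S)"
    using hom S.scalar_mat_hom by (rule ring_hom_trans)
  have one: "scalar_mat S \<one>\<^bsub>S\<^esub> = \<one>\<^bsub>matrix_ring 2 S\<^esub>" "dihedral_rep S (0, False) = \<one>\<^bsub>matrix_ring 2 S\<^esub>"
    by (simp_all add: scalar_mat_def dihedral_rep_def one_mat2 del: matrix_ring_simps)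
  show "c4d6_rep S h z \<in> hom (group_algebra F c4d6) (matrix_ring 2 S)"
    and "c4d6_rep S h z \<one>\<^bsub>group_algebra F c4d6\<^esub> = \<one>\<^bsub>matrix_ring 2 S\<^esub>"
    unfolding c4d6_rep_def
    by (intro extend_hom c4d6_group finite_c4d6 F.ring_axioms M.ring_axioms h' g;
        use hom_in_carrier[OF g] in \<open>auto simp: c4d6_def S.scalar_mat_commute one simp del: matrix_ring_simps\<close>)+
qed

lemma c4_eval_closed [simp]:
  assumes "f \<in> carrier (group_algebra F c4d6)" "x \<in> carrier (dihedral_group 6)"
  shows "c4_eval S h z f x \<in> carrier S"
  using assms unfolding c4_eval_def by (intro S.finsum_closed) (auto simp: c4d6_carrier PiE_iff)

text \<open>The weight is a product of a factor in the cyclic and a factor in the dihedral variable,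
  so the cyclic sum can be carried out alone. Taking for \<open>v\<close> a sign character or a
  matrix entry of \<open>dihedral_rep\<close> shows that characters and representation see
  \<open>f\<close> only through \<open>c4_eval\<close>.\<close>

lemma c4_eval_finsum:
  assumes f: "f \<in> carrier (group_algebra F c4d6)"
    and v: "\<And>x. x \<in> carrier (dihedral_group 6) \<Longrightarrow> v x \<in> carrier S"
  shows "(\<Oplus>\<^bsub>S\<^esub>y\<in>carrier c4d6. h (f y) \<otimes>\<^bsub>S\<^esub> (z [^]\<^bsub>S\<^esub> nat (fst y) \<otimes>\<^bsub>S\<^esub> v (snd y)))
    = (\<Oplus>\<^bsub>S\<^esub>x\<in>carrier (dihedral_group 6). c4_eval S h z f x \<otimes>\<^bsub>S\<^esub> v x)"
proof -
  have fc: "f (i, x) \<in> carrier F" if "i \<in> carrier (integer_mod_group 4)" "x \<in> carrier (dihedral_group 6)" for i x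
    using f that by (auto simp: c4d6_carrier PiE_iff)
  have fin: "finite (carrier (dihedral_group 6))" by simp
  have "(\<Oplus>\<^bsub>S\<^esub>y\<in>carrier c4d6. h (f y) \<otimes>\<^bsub>S\<^esub> (z [^]\<^bsub>S\<^esub> nat (fst y) \<otimes>\<^bsub>S\<^esub> v (snd y)))
     = (\<Oplus>\<^bsub>S\<^esub>x\<in>carrier (dihedral_group 6). \<Oplus>\<^bsub>S\<^esub>i\<in>carrier (integer_mod_group 4).
         h (f (i, x)) \<otimes>\<^bsub>S\<^esub> (z [^]\<^bsub>S\<^esub> nat i \<otimes>\<^bsub>S\<^esub> v x))"
    unfolding c4d6_carrier
    by (subst S.finsum_Times[OF finite_C4 fin]) (use fc v in \<open>auto simp del: dihedral_group_simps(1)\<close>)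
  also have "\<dots> = (\<Oplus>\<^bsub>S\<^esub>x\<in>carrier (dihedral_group 6). c4_eval S h z f x \<otimes>\<^bsub>S\<^esub> v x)"
  proof (rule S.finsum_cong')
    fix x assume x: "x \<in> carrier (dihedral_group 6)"
    have "(\<Oplus>\<^bsub>S\<^esub>i\<in>carrier (integer_mod_group 4). h (f (i, x)) \<otimes>\<^bsub>S\<^esub> (z [^]\<^bsub>S\<^esub> nat i \<otimes>\<^bsub>S\<^esub> v x))
        = (\<Oplus>\<^bsub>S\<^esub>i\<in>carrier (integer_mod_group 4). h (f (i, x)) \<otimes>\<^bsub>S\<^esub> z [^]\<^bsub>S\<^esub> nat i \<otimes>\<^bsub>S\<^esub> v x)"
      using fc[OF _ x] v[OF x] by (intro S.finsum_cong') (auto simp: S.m_assoc)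
    also have "\<dots> = c4_eval S h z f x \<otimes>\<^bsub>S\<^esub> v x"
      unfolding c4_eval_def
      using fc[OF _ x] v[OF x] finite_C4 by (intro S.finsum_ldistr[symmetric]) auto
    finally show "(\<Oplus>\<^bsub>S\<^esub>i\<in>carrier (integer_mod_group 4). h (f (i, x)) \<otimes>\<^bsub>S\<^esub> (z [^]\<^bsub>S\<^esub> nat i \<otimes>\<^bsub>S\<^esub> v x))
        = c4_eval S h z f x \<otimes>\<^bsub>S\<^esub> v x" .
  qed (use f v in \<open>simp_all del: group_algebra_simps dihedral_group_simps(1)\<close>)
  finally show ?thesis .
qed

lemma c4d6_char_eq:
  assumes f: "f \<in> carrier (group_algebra F c4d6)" and e: "e \<in> carrier S"
  shows "c4d6_char S h z e f
    = (\<Oplus>\<^bsub>S\<^esub>x\<in>carrier (dihedral_group 6). c4_eval S h z f x \<otimes>\<^bsub>S\<^esub> (if snd x then e else \<one>\<^bsub>S\<^esub>))"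
  using c4_eval_finsum[OF f, of "\<lambda>x. if snd x then e else \<one>\<^bsub>S\<^esub>"] e
  by (simp add: c4d6_char_def extend_hom_def case_prod_beta)

lemma c4d6_rep_eq:
  assumes f: "f \<in> carrier (group_algebra F c4d6)" and ij: "i < 2" "j < 2"
  shows "c4d6_rep S h z f (i, j)
    = (\<Oplus>\<^bsub>S\<^esub>x\<in>carrier (dihedral_group 6). c4_eval S h z f x \<otimes>\<^bsub>S\<^esub> dihedral_rep S x (i, j))"
proof -
  have D: "dihedral_rep S x \<in> carrier (matrix_ring 2 S)" if "x \<in> carrier (dihedral_group 6)" for x
    using S.dihedral_rep_hom that by (rule hom_in_carrier)
  then have Dij: "dihedral_rep S x (i, j) \<in> carrier S" if "x \<in> carrier (dihedral_group 6)" for x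
    using that ij by (fastforce simp: PiE_iff)
  interpret M: ring "matrix_ring 2 S" by (rule S.matrix_ring_is_ring)
  have sc: "scalar_mat S c \<in> carrier (matrix_ring 2 S)" if "c \<in> carrier S" for c
    using S.scalar_mat_hom that by (rule ring_hom_closed)
  have fc: "f y \<in> carrier F" if "y \<in> carrier c4d6" for y
    using f that by (auto simp: PiE_iff)
  have "c4d6_rep S h z f (i, j) = (\<Oplus>\<^bsub>S\<^esub>y\<in>carrier c4d6.
      (scalar_mat S (h (f y)) \<otimes>\<^bsub>matrix_ring 2 S\<^esub> (scalar_mat S (z [^]\<^bsub>S\<^esub> nat (fst y)) \<otimes>\<^bsub>matrix_ring 2 S\<^esub> dihedral_rep S (snd y))) (i, j))"
    unfolding c4d6_rep_def extend_hom_def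
    by (subst S.matrix_finsum_apply[OF finite_c4d6 _ ij])
      (use fc D sc in \<open>auto simp: c4d6_carrier case_prod_beta simp del: matrix_ring_simps dihedral_group_simps(1)\<close>)
  also have "\<dots> = (\<Oplus>\<^bsub>S\<^esub>y\<in>carrier c4d6. h (f y) \<otimes>\<^bsub>S\<^esub> (z [^]\<^bsub>S\<^esub> nat (fst y) \<otimes>\<^bsub>S\<^esub> dihedral_rep S (snd y) (i, j)))"
    using fc D sc Dij ij
    by (intro S.finsum_cong')
      (auto simp: c4d6_carrier S.scalar_mat_mult_apply simp del: matrix_ring_simps dihedral_group_simps(1))
  also have "\<dots> = (\<Oplus>\<^bsub>S\<^esub>x\<in>carrier (dihedral_group 6). c4_eval S h z f x \<otimes>\<^bsub>S\<^esub> dihedral_rep S x (i, j))"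
    by (rule c4_eval_finsum[OF f Dij])
  finally show ?thesis .
qed

end

section \<open>Inversion of the dihedral and of the cyclic transform\<close>

lemma (in domain) two_cancel:
  assumes "\<one> \<oplus> \<one> \<noteq> \<zero>" "x \<in> carrier R" "y \<in> carrier R" "x \<oplus> x = y \<oplus> y"
  shows "x = y"
proof -
  have "(\<one> \<oplus> \<one>) \<otimes> x = (\<one> \<oplus> \<one>) \<otimes> y"
    using assms(2-4) by (simp add: l_distr)
  then show ?thesis
    using assms(1-3) by (subst (asm) m_lcancel) auto
qed

lemma (in domain) three_cancel:
  assumes "\<one> \<oplus> \<one> \<oplus> \<one> \<noteq> \<zero>" "x \<in> carrier R" "y \<in> carrier R" "x \<oplus> x \<oplus> x = y \<oplus> y \<oplus> y"
  shows "x = y"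
proof -
  have "(\<one> \<oplus> \<one> \<oplus> \<one>) \<otimes> x = (\<one> \<oplus> \<one> \<oplus> \<one>) \<otimes> y"
    using assms(2-4) by (simp add: l_distr)
  then show ?thesis
    using assms(1-3) by (subst (asm) m_lcancel) auto
qed

text \<open>Fourier inversion: if \<open>E\<close> is the matrix with entries \<open>e00, e01, e10, e11\<close>, then \<open>3 f(g)\<close> is the
  sum of \<open>f\<close> over the coset of rotations containing \<open>g\<close> plus the trace of \<open>\<rho>(g\<^sup>-\<^sup>1) E\<close>.\<close>

lemma (in domain) dihedral_transform_inj:
  assumes two: "\<one> \<oplus> \<one> \<noteq> \<zero>" and three: "\<one> \<oplus> \<one> \<oplus> \<one> \<noteq> \<zero>"
    and [simp]: "a0 \<in> carrier R" "a1 \<in> carrier R" "a2 \<in> carrier R" "b0 \<in> carrier R" "b1 \<in> carrier R" "b2 \<in> carrier R"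
    "c0 \<in> carrier R" "c1 \<in> carrier R" "c2 \<in> carrier R" "d0 \<in> carrier R" "d1 \<in> carrier R" "d2 \<in> carrier R"
    and p: "a0 \<oplus> a1 \<oplus> a2 \<oplus> b0 \<oplus> b1 \<oplus> b2 = c0 \<oplus> c1 \<oplus> c2 \<oplus> d0 \<oplus> d1 \<oplus> d2"
    and m: "a0 \<oplus> a1 \<oplus> a2 \<oplus> \<ominus> b0 \<oplus> \<ominus> b1 \<oplus> \<ominus> b2 = c0 \<oplus> c1 \<oplus> c2 \<oplus> \<ominus> d0 \<oplus> \<ominus> d1 \<oplus> \<ominus> d2"
    and e00: "a0 \<oplus> \<ominus> a2 \<oplus> \<ominus> b1 \<oplus> b2 = c0 \<oplus> \<ominus> c2 \<oplus> \<ominus> d1 \<oplus> d2"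
    and e01: "\<ominus> a1 \<oplus> a2 \<oplus> b0 \<oplus> \<ominus> b2 = \<ominus> c1 \<oplus> c2 \<oplus> d0 \<oplus> \<ominus> d2"
    and e10: "a1 \<oplus> \<ominus> a2 \<oplus> b0 \<oplus> \<ominus> b1 = c1 \<oplus> \<ominus> c2 \<oplus> d0 \<oplus> \<ominus> d1"
    and e11: "a0 \<oplus> \<ominus> a1 \<oplus> b1 \<oplus> \<ominus> b2 = c0 \<oplus> \<ominus> c1 \<oplus> d1 \<oplus> \<ominus> d2"
  shows "a0 = c0 \<and> a1 = c1 \<and> a2 = c2 \<and> b0 = d0 \<and> b1 = d1 \<and> b2 = d2"
proof -
  \<comment> \<open>The trivial and the sign character give the sum and the difference of the total
    over the rotations and the total over the reflections; twice each total is recovered.\<close>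
  have sums: "(x0 \<oplus> x1 \<oplus> x2) \<oplus> (x0 \<oplus> x1 \<oplus> x2) = (x0 \<oplus> x1 \<oplus> x2 \<oplus> y0 \<oplus> y1 \<oplus> y2) \<oplus> (x0 \<oplus> x1 \<oplus> x2 \<oplus> \<ominus> y0 \<oplus> \<ominus> y1 \<oplus> \<ominus> y2)"
      "(y0 \<oplus> y1 \<oplus> y2) \<oplus> (y0 \<oplus> y1 \<oplus> y2) = (x0 \<oplus> x1 \<oplus> x2 \<oplus> y0 \<oplus> y1 \<oplus> y2) \<oplus> \<ominus> (x0 \<oplus> x1 \<oplus> x2 \<oplus> \<ominus> y0 \<oplus> \<ominus> y1 \<oplus> \<ominus> y2)"
    if "x0 \<in> carrier R" "x1 \<in> carrier R" "x2 \<in> carrier R" "y0 \<in> carrier R" "y1 \<in> carrier R" "y2 \<in> carrier R"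
    for x0 x1 x2 y0 y1 y2
    using that by algebra+
  note sums_a = sums[OF assms(3-8), unfolded p m] and sums_c = sums[OF assms(9-14)]
  have x: "a0 \<oplus> a1 \<oplus> a2 = c0 \<oplus> c1 \<oplus> c2" and y: "b0 \<oplus> b1 \<oplus> b2 = d0 \<oplus> d1 \<oplus> d2"
    by (rule two_cancel[OF two _ _ trans[OF sums_a(1) sums_c(1)[symmetric]]]
        two_cancel[OF two _ _ trans[OF sums_a(2) sums_c(2)[symmetric]]]; simp)+
  have inversion:
      "x0 \<oplus> x0 \<oplus> x0 = (x0 \<oplus> x1 \<oplus> x2)
        \<oplus> (x0 \<oplus> \<ominus> x2 \<oplus> \<ominus> y1 \<oplus> y2) \<oplus> (x0 \<oplus> \<ominus> x1 \<oplus> y1 \<oplus> \<ominus> y2)"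
      "x1 \<oplus> x1 \<oplus> x1 = (x0 \<oplus> x1 \<oplus> x2)
        \<oplus> \<ominus> (x0 \<oplus> \<ominus> x2 \<oplus> \<ominus> y1 \<oplus> y2) \<oplus> (x1 \<oplus> \<ominus> x2 \<oplus> y0 \<oplus> \<ominus> y1) \<oplus> \<ominus> (\<ominus> x1 \<oplus> x2 \<oplus> y0 \<oplus> \<ominus> y2)"
      "x2 \<oplus> x2 \<oplus> x2 = (x0 \<oplus> x1 \<oplus> x2)
        \<oplus> \<ominus> (x1 \<oplus> \<ominus> x2 \<oplus> y0 \<oplus> \<ominus> y1) \<oplus> (\<ominus> x1 \<oplus> x2 \<oplus> y0 \<oplus> \<ominus> y2) \<oplus> \<ominus> (x0 \<oplus> \<ominus> x1 \<oplus> y1 \<oplus> \<ominus> y2)"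
      "y0 \<oplus> y0 \<oplus> y0 = (y0 \<oplus> y1 \<oplus> y2)
        \<oplus> (\<ominus> x1 \<oplus> x2 \<oplus> y0 \<oplus> \<ominus> y2) \<oplus> (x1 \<oplus> \<ominus> x2 \<oplus> y0 \<oplus> \<ominus> y1)"
      "y1 \<oplus> y1 \<oplus> y1 = (y0 \<oplus> y1 \<oplus> y2)
        \<oplus> \<ominus> (x0 \<oplus> \<ominus> x2 \<oplus> \<ominus> y1 \<oplus> y2) \<oplus> \<ominus> (\<ominus> x1 \<oplus> x2 \<oplus> y0 \<oplus> \<ominus> y2) \<oplus> (x0 \<oplus> \<ominus> x1 \<oplus> y1 \<oplus> \<ominus> y2)"
      "y2 \<oplus> y2 \<oplus> y2 = (y0 \<oplus> y1 \<oplus> y2)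
        \<oplus> (x0 \<oplus> \<ominus> x2 \<oplus> \<ominus> y1 \<oplus> y2) \<oplus> \<ominus> (x1 \<oplus> \<ominus> x2 \<oplus> y0 \<oplus> \<ominus> y1) \<oplus> \<ominus> (x0 \<oplus> \<ominus> x1 \<oplus> y1 \<oplus> \<ominus> y2)"
    if "x0 \<in> carrier R" "x1 \<in> carrier R" "x2 \<in> carrier R" "y0 \<in> carrier R" "y1 \<in> carrier R" "y2 \<in> carrier R"
    for x0 x1 x2 y0 y1 y2
    using that by algebra+
  \<comment> \<open>The right-hand sides consist of the very combinations occurring in
    \<open>x\<close>, \<open>y\<close> and \<open>e00\<close> to \<open>e11\<close>, bracketed
    alike, so rewriting turns the formulas for the first family into those for the second.\<close>
  note inv_a = inversion[OF assms(3-8), unfolded x y e00 e01 e10 e11]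
  note inv_c = inversion[OF assms(9-14), symmetric]
  show ?thesis
    by (intro conjI; rule three_cancel[OF three _ _ trans[OF inv_a(1) inv_c(1)]]
        three_cancel[OF three _ _ trans[OF inv_a(2) inv_c(2)]]
        three_cancel[OF three _ _ trans[OF inv_a(3) inv_c(3)]]
        three_cancel[OF three _ _ trans[OF inv_a(4) inv_c(4)]]
        three_cancel[OF three _ _ trans[OF inv_a(5) inv_c(5)]]
        three_cancel[OF three _ _ trans[OF inv_a(6) inv_c(6)]]; fact assms(3-14))
qed

text \<open>Fourier inversion on a group of order 2; the transform of order 4 is undone by applying
  it twice.\<close>

lemma (in domain) sum_diff_cancel:
  assumes two: "\<one> \<oplus> \<one> \<noteq> \<zero>"
    and [simp]: "a \<in> carrier R" "b \<in> carrier R" "c \<in> carrier R" "d \<in> carrier R"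
    and s: "a \<oplus> b = c \<oplus> d" and m: "a \<ominus> b = c \<ominus> d"
  shows "a = c" "b = d"
proof -
  have id: "x \<oplus> x = (x \<oplus> y) \<oplus> (x \<ominus> y)" "y \<oplus> y = (x \<oplus> y) \<ominus> (x \<ominus> y)"
    if "x \<in> carrier R" "y \<in> carrier R" for x y
    using that by algebra+
  show "a = c"
    by (rule two_cancel[OF two _ _ trans[OF id(1)[OF assms(2,3), unfolded s m] id(1)[OF assms(4,5), symmetric]]]) simp_all
  show "b = d"
    by (rule two_cancel[OF two _ _ trans[OF id(2)[OF assms(2,3), unfolded s m] id(2)[OF assms(4,5), symmetric]]]) simp_all
qed

lemma (in root_eval) c4_eval_eq:
  assumes "f \<in> carrier (group_algebra F c4d6)" "x \<in> carrier (dihedral_group 6)"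
  shows "c4_eval S h z f x = h (f (0, x)) \<oplus>\<^bsub>S\<^esub> h (f (1, x)) \<otimes>\<^bsub>S\<^esub> z
    \<oplus>\<^bsub>S\<^esub> h (f (2, x)) \<otimes>\<^bsub>S\<^esub> (z \<otimes>\<^bsub>S\<^esub> z) \<oplus>\<^bsub>S\<^esub> h (f (3, x)) \<otimes>\<^bsub>S\<^esub> (z \<otimes>\<^bsub>S\<^esub> z \<otimes>\<^bsub>S\<^esub> z)"
proof -
  have c: "h (f (i, x)) \<in> carrier S" if "i \<in> carrier (integer_mod_group 4)" for i
    using assms that by (auto simp: c4d6_carrier PiE_iff)
  have 2: "z [^]\<^bsub>S\<^esub> (2::nat) = z \<otimes>\<^bsub>S\<^esub> z" "z [^]\<^bsub>S\<^esub> (3::nat) = z \<otimes>\<^bsub>S\<^esub> z \<otimes>\<^bsub>S\<^esub> z"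
    by (simp_all add: numeral_2_eq_2 numeral_3_eq_3)
  show ?thesis
    unfolding c4_eval_def
    by (subst S.finsum_cyclic_4; (intro S.m_closed S.nat_pow_closed c z)?)
      (use c in \<open>simp_all add: 2 carrier_integer_mod_group\<close>)
qed

text \<open>In a domain the last two assumptions allow cancellation of 2 and 3, hence of the order
  of \<open>D_6\<close>.\<close>

locale root_eval_domain = root_eval F S h z + S: domain S
  for F :: "('a, 'm) ring_scheme" and S :: "('b, 'n) ring_scheme" and h z +
  assumes two: "\<one>\<^bsub>S\<^esub> \<oplus>\<^bsub>S\<^esub> \<one>\<^bsub>S\<^esub> \<noteq> \<zero>\<^bsub>S\<^esub>"
    and three: "\<one>\<^bsub>S\<^esub> \<oplus>\<^bsub>S\<^esub> \<one>\<^bsub>S\<^esub> \<oplus>\<^bsub>S\<^esub> \<one>\<^bsub>S\<^esub> \<noteq> \<zero>\<^bsub>S\<^esub>"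
begin

text \<open>The dihedral stage: at a fixed \<open>z\<close>, two characters and four matrix entries
  are six linear forms in the six values of \<open>c4_eval\<close>, and they determine these
  values.\<close>

lemma c4_eval_inj:
  assumes f: "f \<in> carrier (group_algebra F c4d6)" and f': "f' \<in> carrier (group_algebra F c4d6)"
    and p: "c4d6_char S h z \<one>\<^bsub>S\<^esub> f = c4d6_char S h z \<one>\<^bsub>S\<^esub> f'"
    and m: "c4d6_char S h z (\<ominus>\<^bsub>S\<^esub> \<one>\<^bsub>S\<^esub>) f = c4d6_char S h z (\<ominus>\<^bsub>S\<^esub> \<one>\<^bsub>S\<^esub>) f'"
    and r: "c4d6_rep S h z f = c4d6_rep S h z f'"
    and x: "x \<in> carrier (dihedral_group 6)"
  shows "c4_eval S h z f x = c4_eval S h z f' x"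
proof -
  let ?w = "c4_eval S h z"
  have c: "?w g (i, b) \<in> carrier S" if "g \<in> carrier (group_algebra F c4d6)" "i \<in> {0, 1, 2}" for g i b
    using c4_eval_closed[OF that(1)] that(2) by (auto simp: carrier_dihedral_group_6)
  have 6: "(\<Oplus>\<^bsub>S\<^esub>y\<in>carrier (dihedral_group 6). ?w g y \<otimes>\<^bsub>S\<^esub> v y) =
     ?w g (0, False) \<otimes>\<^bsub>S\<^esub> v (0, False) \<oplus>\<^bsub>S\<^esub> ?w g (1, False) \<otimes>\<^bsub>S\<^esub> v (1, False)
     \<oplus>\<^bsub>S\<^esub> ?w g (2, False) \<otimes>\<^bsub>S\<^esub> v (2, False) \<oplus>\<^bsub>S\<^esub> ?w g (0, True) \<otimes>\<^bsub>S\<^esub> v (0, True)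
     \<oplus>\<^bsub>S\<^esub> ?w g (1, True) \<otimes>\<^bsub>S\<^esub> v (1, True) \<oplus>\<^bsub>S\<^esub> ?w g (2, True) \<otimes>\<^bsub>S\<^esub> v (2, True)"
    if "g \<in> carrier (group_algebra F c4d6)" "\<And>y. y \<in> carrier (dihedral_group 6) \<Longrightarrow> v y \<in> carrier S" for g v
    using c4_eval_closed[OF that(1)] that(2) by (intro S.finsum_dihedral_group_6) auto
  have Dij: "dihedral_rep S y (i, j) \<in> carrier S" if "y \<in> carrier (dihedral_group 6)" "i < 2" "j < 2" for y i j
    using hom_in_carrier[OF S.dihedral_rep_hom that(1)] that(2,3) by (auto simp: PiE_iff)
  have ch: "c4d6_char S h z e g = ?w g (0, False) \<oplus>\<^bsub>S\<^esub> ?w g (1, False) \<oplus>\<^bsub>S\<^esub> ?w g (2, False)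
     \<oplus>\<^bsub>S\<^esub> ?w g (0, True) \<otimes>\<^bsub>S\<^esub> e \<oplus>\<^bsub>S\<^esub> ?w g (1, True) \<otimes>\<^bsub>S\<^esub> e \<oplus>\<^bsub>S\<^esub> ?w g (2, True) \<otimes>\<^bsub>S\<^esub> e"
    if "g \<in> carrier (group_algebra F c4d6)" "e \<in> carrier S" for g e
    unfolding c4d6_char_eq[OF that]
    by (subst 6) (use that c[OF that(1)] in \<open>simp_all del: group_algebra_simps\<close>)
  have rep: "c4d6_rep S h z g (i, j) = ?w g (0, False) \<otimes>\<^bsub>S\<^esub> dihedral_rep S (0, False) (i, j)
     \<oplus>\<^bsub>S\<^esub> ?w g (1, False) \<otimes>\<^bsub>S\<^esub> dihedral_rep S (1, False) (i, j) \<oplus>\<^bsub>S\<^esub> ?w g (2, False) \<otimes>\<^bsub>S\<^esub> dihedral_rep S (2, False) (i, j)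
     \<oplus>\<^bsub>S\<^esub> ?w g (0, True) \<otimes>\<^bsub>S\<^esub> dihedral_rep S (0, True) (i, j)
     \<oplus>\<^bsub>S\<^esub> ?w g (1, True) \<otimes>\<^bsub>S\<^esub> dihedral_rep S (1, True) (i, j) \<oplus>\<^bsub>S\<^esub> ?w g (2, True) \<otimes>\<^bsub>S\<^esub> dihedral_rep S (2, True) (i, j)"
    if "g \<in> carrier (group_algebra F c4d6)" "i < 2" "j < 2" for g i j
    unfolding c4d6_rep_eq[OF that] by (intro 6 Dij that)
  have entry: "c4d6_rep S h z f (i, j) = c4d6_rep S h z f' (i, j)" for i j
    using r by simp
  have "?w f (0, False) = ?w f' (0, False) \<and> ?w f (1, False) = ?w f' (1, False) \<and> ?w f (2, False) = ?w f' (2, False)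
    \<and> ?w f (0, True) = ?w f' (0, True) \<and> ?w f (1, True) = ?w f' (1, True) \<and> ?w f (2, True) = ?w f' (2, True)"
    using p m entry[of 0 0] entry[of 0 "Suc 0"] entry[of "Suc 0" 0] entry[of "Suc 0" "Suc 0"] c[OF f] c[OF f']
    by (intro S.dihedral_transform_inj[OF two three])
      (simp_all add: ch[OF f] ch[OF f'] rep[OF f] rep[OF f'] dihedral_rep_def S.r_minus
        del: group_algebra_simps)
  then show ?thesis
    using x unfolding carrier_dihedral_group_6 by (cases "snd x") auto
qed

end

text \<open>Values at \<open>z\<close> and at its negative separate the even from the odd part of a
  cubic polynomial; \<open>z \<noteq> \<zero>\<close> cancels the extra factor in the odd part. The
  square \<open>e\<close> is a parameter because it is 1 for the roots 1 and -1, and -1 for the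
  other two.\<close>

lemma (in domain) c4_transform_sums:
  assumes two: "\<one> \<oplus> \<one> \<noteq> \<zero>"
    and c [simp]: "a0 \<in> carrier R" "a1 \<in> carrier R" "a2 \<in> carrier R" "a3 \<in> carrier R"
      "b0 \<in> carrier R" "b1 \<in> carrier R" "b2 \<in> carrier R" "b3 \<in> carrier R"
      "z \<in> carrier R"
    and z: "z \<otimes> z = e" "e \<in> carrier R" "z \<noteq> \<zero>"
    and p: "a0 \<oplus> a1 \<otimes> z \<oplus> a2 \<otimes> (z \<otimes> z) \<oplus> a3 \<otimes> (z \<otimes> z \<otimes> z)
      = b0 \<oplus> b1 \<otimes> z \<oplus> b2 \<otimes> (z \<otimes> z) \<oplus> b3 \<otimes> (z \<otimes> z \<otimes> z)"
    and m: "a0 \<oplus> a1 \<otimes> (\<ominus> z) \<oplus> a2 \<otimes> (\<ominus> z \<otimes> \<ominus> z) \<oplus> a3 \<otimes> (\<ominus> z \<otimes> \<ominus> z \<otimes> \<ominus> z)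
      = b0 \<oplus> b1 \<otimes> (\<ominus> z) \<oplus> b2 \<otimes> (\<ominus> z \<otimes> \<ominus> z) \<oplus> b3 \<otimes> (\<ominus> z \<otimes> \<ominus> z \<otimes> \<ominus> z)"
  shows "a0 \<oplus> a2 \<otimes> e = b0 \<oplus> b2 \<otimes> e" "a1 \<oplus> a3 \<otimes> e = b1 \<oplus> b3 \<otimes> e"
proof -
  have id: "x0 \<oplus> x1 \<otimes> z \<oplus> x2 \<otimes> (z \<otimes> z) \<oplus> x3 \<otimes> (z \<otimes> z \<otimes> z) = (x0 \<oplus> x2 \<otimes> e) \<oplus> z \<otimes> (x1 \<oplus> x3 \<otimes> e)"
    "x0 \<oplus> x1 \<otimes> (\<ominus> z) \<oplus> x2 \<otimes> (\<ominus> z \<otimes> \<ominus> z) \<oplus> x3 \<otimes> (\<ominus> z \<otimes> \<ominus> z \<otimes> \<ominus> z)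
      = (x0 \<oplus> x2 \<otimes> e) \<ominus> z \<otimes> (x1 \<oplus> x3 \<otimes> e)"
    if "x0 \<in> carrier R" "x1 \<in> carrier R" "x2 \<in> carrier R" "x3 \<in> carrier R" for x0 x1 x2 x3
    using that c(9) unfolding z(1)[symmetric] by algebra+
  note sd = sum_diff_cancel[OF two _ _ _ _ p[unfolded id[OF c(1-4)] id[OF c(5-8)]] m[unfolded id[OF c(1-4)] id[OF c(5-8)]]]
  show "a0 \<oplus> a2 \<otimes> e = b0 \<oplus> b2 \<otimes> e"
    using z(2) by (intro sd(1)) simp_all
  have "z \<otimes> (a1 \<oplus> a3 \<otimes> e) = z \<otimes> (b1 \<oplus> b3 \<otimes> e)"
    using z(2) by (intro sd(2)) simp_all
  then show "a1 \<oplus> a3 \<otimes> e = b1 \<oplus> b3 \<otimes> e"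
    using z(2,3) by (subst (asm) m_lcancel) simp_all
qed

subsection \<open>Finite fields\<close>

text \<open>Powers of a generator of the multiplicative group give a surjection from the cyclic
  group; equal cardinalities make it injective.\<close>

lemma (in field) units_of_finite_field_iso:
  assumes fin: "finite (carrier R)"
  shows "units_of R \<cong> integer_mod_group (card (carrier R) - 1)"
proof -
  define n where "n = card (carrier R) - 1"
  interpret U: group "Multiplicative_Group.mult_of R" by (rule field_mult_group)
  have card: "card (carrier (Multiplicative_Group.mult_of R)) = n"
    using order_mult_of[OF fin] by (simp add: order_def n_def)
  \<comment> \<open>Excludes the degenerate case in which \<open>integer_mod_group n\<close> is
    infinite.\<close>
  have n: "n > 0"
    using card fin U.one_closed by (metis card_gt_0_iff empty_iff finite_mult_of)
  obtain a where a: "a \<in> carrier (Multiplicative_Group.mult_of R)" "carrier (Multiplicative_Group.mult_of R) = {a [^] i | i::nat. i \<in> UNIV}"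
    using finite_field_mult_group_has_gen[OF fin] by blast
  have an: "a [^]\<^bsub>Multiplicative_Group.mult_of R\<^esub> n = \<one>\<^bsub>Multiplicative_Group.mult_of R\<^esub>"
    using U.pow_order_eq_1[OF a(1)] card by (simp add: order_def)
  let ?h = "\<lambda>i. a [^]\<^bsub>Multiplicative_Group.mult_of R\<^esub> nat i"
  have hom: "?h \<in> hom (integer_mod_group n) (Multiplicative_Group.mult_of R)"
    using a(1) an n by (rule U.integer_mod_group_hom)
  have "carrier (Multiplicative_Group.mult_of R) \<subseteq> ?h ` carrier (integer_mod_group n)"
  proof
    fix y assume "y \<in> carrier (Multiplicative_Group.mult_of R)"
    then obtain i :: nat where i: "y = a [^]\<^bsub>Multiplicative_Group.mult_of R\<^esub> i"
      using a(2) by (auto simp: Multiplicative_Group.nat_pow_mult_of)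
    have "y = ?h (int (i mod n))"
      using U.nat_pow_mod[OF a(1) an, of i] by (simp add: i)
    then show "y \<in> ?h ` carrier (integer_mod_group n)"
      by (rule image_eqI) (use n in \<open>simp add: carrier_integer_mod_group\<close>)
  qed
  moreover have "?h ` carrier (integer_mod_group n) \<subseteq> carrier (Multiplicative_Group.mult_of R)"
    using hom by (auto simp: hom_def)
  ultimately have surj: "?h ` carrier (integer_mod_group n) = carrier (Multiplicative_Group.mult_of R)" by simp
  have "inj_on ?h (carrier (integer_mod_group n))"
    by (intro eq_card_imp_inj_on, unfold surj card) (use n in \<open>simp_all add: carrier_integer_mod_group\<close>)
  with hom surj have "?h \<in> iso (integer_mod_group n) (Multiplicative_Group.mult_of R)"
    by (auto simp: iso_def bij_betw_def)
  then have "integer_mod_group n \<cong> Multiplicative_Group.mult_of R" by (auto simp: is_iso_def)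
  then show ?thesis
    using group.iso_sym[OF group_integer_mod_group] by (simp add: mult_of_is_Units n_def)
qed

text \<open>With 4m units, the at most 2m solutions of \<open>x [^] (2 * m) = \<one>\<close> cannot
  exhaust them. Any other unit has \<open>x [^] (2 * m)\<close> of square 1 but different from 1,
  hence equal to -1, and \<open>x [^] m\<close> is the root sought.\<close>

lemma (in field) sqrt_minus_one_exists:
  assumes fin: "finite (carrier R)" and "4 dvd card (carrier R) - 1"
  shows "\<exists>w\<in>carrier R. w \<otimes> w = \<ominus> \<one>"
proof -
  interpret U: group "Multiplicative_Group.mult_of R" by (rule field_mult_group)
  obtain m where m: "card (carrier R) - 1 = 4 * m" using assms(2) by (auto elim: dvdE)
  have card: "card (carrier (Multiplicative_Group.mult_of R)) = 4 * m"
    using order_mult_of[OF fin] m by (simp add: order_def)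
  have m0: "m > 0"
    using card fin U.one_closed by (metis card_gt_0_iff empty_iff finite_mult_of mult_is_0 neq0_conv)
  have "card {x \<in> carrier R. x [^] (2 * m) = \<one>} \<le> 2 * m"
    using m0 by (intro num_roots_le_deg[OF fin]) simp
  also have "\<dots> < card (carrier (Multiplicative_Group.mult_of R))" using card m0 by simp
  finally have "\<not> carrier (Multiplicative_Group.mult_of R) \<subseteq> {x \<in> carrier R. x [^] (2 * m) = \<one>}"
    using fin by (metis (no_types, lifting) card_mono finite_subset leD mem_Collect_eq subsetI)
  then obtain x where x: "x \<in> carrier (Multiplicative_Group.mult_of R)" "x [^] (2 * m) \<noteq> \<one>" by auto
  then have xc: "x \<in> carrier R" by simp
  have "x [^]\<^bsub>Multiplicative_Group.mult_of R\<^esub> (4 * m) = \<one>\<^bsub>Multiplicative_Group.mult_of R\<^esub>"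
    using U.pow_order_eq_1[OF x(1)] card by (simp add: order_def)
  then have "x [^] (2 * m) \<otimes> x [^] (2 * m) = \<one>"
    using xc by (simp add: Multiplicative_Group.nat_pow_mult_of nat_pow_mult)
  then have "x [^] (2 * m) = \<ominus> \<one>"
    using square_eq_one[of "x [^] (2 * m)"] x xc by auto
  then have "x [^] m \<otimes> x [^] m = \<ominus> \<one>"
    using xc by (simp add: nat_pow_mult mult_2)
  then show ?thesis using xc by blast
qed

text \<open>A square root of -1 has fourth power 1, so its power with exponent 4m + 2 is -1; but 4m
  + 2 is the number of units, which makes that power 1.\<close>

lemma (in field) no_sqrt_minus_one:
  assumes fin: "finite (carrier R)" and card: "card (carrier R) = 4 * m + 3"
    and two: "\<one> \<oplus> \<one> \<noteq> \<zero>" and w: "w \<in> carrier R"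
  shows "w \<otimes> w \<noteq> \<ominus> \<one>"
proof
  assume ww: "w \<otimes> w = \<ominus> \<one>"
  interpret U: group "Multiplicative_Group.mult_of R" by (rule field_mult_group)
  have "w \<noteq> \<zero>"
    using ww by (metis l_null minus_equality minus_minus minus_zero one_closed one_not_zero r_zero zero_closed w)
  then have "w [^]\<^bsub>Multiplicative_Group.mult_of R\<^esub> (4 * m + 2) = \<one>\<^bsub>Multiplicative_Group.mult_of R\<^esub>"
    using U.pow_order_eq_1[of w] order_mult_of[OF fin] card w by (simp add: order_def)
  then have 1: "w [^] (4 * m + 2) = \<one>" by (simp add: Multiplicative_Group.nat_pow_mult_of)
  have w2: "w [^] (2::nat) = \<ominus> \<one>" using ww w by (simp add: numeral_2_eq_2)
  have "w [^] (4::nat) = w [^] (2::nat) \<otimes> w [^] (2::nat)"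
    using w by (simp add: nat_pow_mult)
  then have w4: "w [^] (4::nat) = \<one>" using w2 by (simp add: l_minus)
  have "w [^] (4 * m + 2) = (w [^] (4::nat)) [^] m \<otimes> w [^] (2::nat)"
    using w by (simp only: nat_pow_pow nat_pow_mult nat_pow_closed)
  then have "\<one> = \<ominus> \<one>" using 1 w2 w4 by simp
  then have "\<one> \<oplus> \<one> = \<zero>" by (metis l_neg one_closed)
  with two show False by simp
qed

text \<open>Adjoining a vector outside \<open>E\<close> multiplies the size by that of
  \<open>K\<close>, because each element of the line extension has a unique expression
  \<open>k \<otimes> v \<oplus> e\<close>.\<close>

lemma (in ring) card_dimension:
  assumes "dimension n K E" and "subfield K R" and "finite K"
  shows "finite E \<and> card E = card K ^ n"
  using assms
proof (induction rule: dimension.induct)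
  case zero_dim
  show ?case by simp
next
  case (Suc_dim v E n K)
  note K = Suc_dim.prems(1)
  obtain Us where Us: "set Us \<subseteq> carrier R" "Span K Us = E"
    using exists_base[OF K Suc_dim.hyps(3)] by auto
  note props = Span_subgroup_props[OF K Us(1), unfolded Us(2)]
  have Kc: "K \<subseteq> carrier R" using subfieldE(3)[OF K] .
  have inj: "inj_on (\<lambda>(k, e). k \<otimes> v \<oplus> e) (K \<times> E)"
  proof (rule inj_onI, clarify)
    fix k e k' e' assume ke: "k \<in> K" "e \<in> E" "k' \<in> K" "e' \<in> E" and eq: "k \<otimes> v \<oplus> e = k' \<otimes> v \<oplus> e'"
    have c: "k \<in> carrier R" "e \<in> carrier R" "k' \<in> carrier R" "e' \<in> carrier R" using ke Kc props(1) by auto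
    \<comment> \<open>The difference of two expressions puts a multiple of \<open>v\<close> into
      \<open>E\<close>; a nonzero scalar could be inverted, contradicting that \<open>v\<close> lies
      outside \<open>E\<close>.\<close>
    have "(k \<ominus> k') \<otimes> v = (k \<otimes> v \<oplus> e) \<ominus> e \<ominus> k' \<otimes> v"
      using c Suc_dim.hyps(1) by algebra
    also have "\<dots> = e' \<oplus> \<ominus> e"
      unfolding eq using c Suc_dim.hyps(1) by algebra
    finally have "(k \<ominus> k') \<otimes> v \<in> E"
      using props(3,4) ke by simp
    moreover have "k \<ominus> k' \<in> K"
      using ke subring_props(5,7)[OF K] by (simp add: a_minus_def)
    ultimately have "k \<ominus> k' = \<zero>"
      using Span_m_inv_simprule[OF K Us(1), unfolded Us(2), of "k \<ominus> k'" v] Suc_dim.hyps(1,2) by blast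
    then have "k = k'" using c by simp
    then show "k = k' \<and> e = e'" using eq c Suc_dim.hyps(1) by simp
  qed
  have "line_extension K v E = (\<lambda>(k, e). k \<otimes> v \<oplus> e) ` (K \<times> E)"
    by (auto simp: line_extension_mem_iff) blast
  then show ?case
    using Suc_dim.IH Suc_dim.prems inj by (simp add: card_image card_cartesian_product)
qed

subsection \<open>Decomposition of the group algebra\<close>

lemma units_of_iso_card:
  assumes "\<And>x y. x \<in> carrier M \<Longrightarrow> y \<in> carrier M \<Longrightarrow> x \<otimes>\<^bsub>M\<^esub> y \<in> carrier M" "\<one>\<^bsub>M\<^esub> \<in> carrier M"
    and "h \<in> hom M N" "h \<one>\<^bsub>M\<^esub> = \<one>\<^bsub>N\<^esub>" "inj_on h (carrier M)"
    and "finite (carrier N)" "card (carrier M) = card (carrier N)"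
  shows "units_of M \<cong> units_of N"
proof (rule units_of_iso[OF assms(1-4)])
  have "h ` carrier M = carrier N"
    using assms by (intro card_subset_eq) (auto simp: hom_def card_image)
  with assms(5) show "bij_betw h (carrier M) (carrier N)"
    by (simp add: bij_betw_def)
qed

lemma card_matrix_ring: "finite (carrier R) \<Longrightarrow> card (carrier (matrix_ring n R)) = card (carrier R) ^ (n * n)"
  by (simp add: card_funcsetE card_cartesian_product)

lemma carrier_group_power [simp]: "carrier (group_power M m) = {..<m} \<rightarrow>\<^sub>E carrier M"
  by (simp add: group_power_def)

lemma one_group_power [simp]: "\<one>\<^bsub>group_power M m\<^esub> = (\<lambda>i\<in>{..<m}. \<one>\<^bsub>M\<^esub>)"
  by (simp add: group_power_def)

lemma group_group_power: "group M \<Longrightarrow> group (group_power M m)"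
  by (simp add: group_power_def)

lemma (in root_eval_domain) c4_eval_pm_sums:
  assumes f: "f \<in> carrier (group_algebra F c4d6)" and f': "f' \<in> carrier (group_algebra F c4d6)"
    and x: "x \<in> carrier (dihedral_group 6)"
    and zz: "z \<otimes>\<^bsub>S\<^esub> z = e" "e \<in> carrier S"
    and p: "c4_eval S h z f x = c4_eval S h z f' x"
    and m: "c4_eval S h (\<ominus>\<^bsub>S\<^esub> z) f x = c4_eval S h (\<ominus>\<^bsub>S\<^esub> z) f' x"
  shows "h (f (0, x)) \<oplus>\<^bsub>S\<^esub> h (f (2, x)) \<otimes>\<^bsub>S\<^esub> e = h (f' (0, x)) \<oplus>\<^bsub>S\<^esub> h (f' (2, x)) \<otimes>\<^bsub>S\<^esub> e"
    and "h (f (1, x)) \<oplus>\<^bsub>S\<^esub> h (f (3, x)) \<otimes>\<^bsub>S\<^esub> e = h (f' (1, x)) \<oplus>\<^bsub>S\<^esub> h (f' (3, x)) \<otimes>\<^bsub>S\<^esub> e"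
proof -
  have c: "h (g (i, x)) \<in> carrier S" if "g \<in> carrier (group_algebra F c4d6)" "i \<in> {0, 1, 2, 3}" for g i
    using that x by (auto simp: c4d6_carrier PiE_iff carrier_integer_mod_group)
  have z0: "z \<noteq> \<zero>\<^bsub>S\<^esub>"
    using z4 by (metis S.nat_pow_zero S.one_not_zero zero_neq_numeral)
  \<comment> \<open>The locale fixes \<open>z\<close>; its negative needs an interpretation of its
    own before the evaluation there can be expanded.\<close>
  have "(\<ominus>\<^bsub>S\<^esub> z) [^]\<^bsub>S\<^esub> (4::nat) = \<one>\<^bsub>S\<^esub>"
  proof -
    have "(\<ominus>\<^bsub>S\<^esub> z) [^]\<^bsub>S\<^esub> (4::nat) = z [^]\<^bsub>S\<^esub> (4::nat)"
      by (simp add: numeral_eq_Suc S.l_minus S.r_minus)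
    then show ?thesis by (simp add: z4)
  qed
  then interpret m: root_eval F S h "\<ominus>\<^bsub>S\<^esub> z"
    by unfold_locales (simp_all add: hom)
  note eqs = S.c4_transform_sums[OF two _ _ _ _ _ _ _ _ z zz z0
      p[unfolded c4_eval_eq[OF f x] c4_eval_eq[OF f' x]]
      m[unfolded m.c4_eval_eq[OF f x] m.c4_eval_eq[OF f' x]]]
  show "h (f (0, x)) \<oplus>\<^bsub>S\<^esub> h (f (2, x)) \<otimes>\<^bsub>S\<^esub> e = h (f' (0, x)) \<oplus>\<^bsub>S\<^esub> h (f' (2, x)) \<otimes>\<^bsub>S\<^esub> e"
    by (rule eqs(1)) (use c[OF f] c[OF f'] in auto)
  show "h (f (1, x)) \<oplus>\<^bsub>S\<^esub> h (f (3, x)) \<otimes>\<^bsub>S\<^esub> e = h (f' (1, x)) \<oplus>\<^bsub>S\<^esub> h (f' (3, x)) \<otimes>\<^bsub>S\<^esub> e"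
    by (rule eqs(2)) (use c[OF f] c[OF f'] in auto)
qed

lemma (in domain) root_eval_domain_id:
  assumes "\<one> \<oplus> \<one> \<noteq> \<zero>" "\<one> \<oplus> \<one> \<oplus> \<one> \<noteq> \<zero>" "z \<in> carrier R" "z \<otimes> z = e" "e \<in> {\<one>, \<ominus> \<one>}"
  shows "root_eval_domain R R (\<lambda>x. x) z"
proof -
  have "z [^] (4::nat) = (z \<otimes> z) \<otimes> (z \<otimes> z)"
    using assms(3) by (simp add: numeral_eq_Suc m_assoc)
  then have "z [^] (4::nat) = \<one>" using assms(4,5) by (auto simp: l_minus)
  then show ?thesis
    using assms by unfold_locales (auto simp: ring_hom_def)
qed

lemma group_algebra_eqI:
  assumes f: "f \<in> carrier (group_algebra F c4d6)" "f' \<in> carrier (group_algebra F c4d6)"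
    and "\<And>x. x \<in> carrier (dihedral_group 6) \<Longrightarrow>
      f (0, x) = f' (0, x) \<and> f (1, x) = f' (1, x) \<and> f (2, x) = f' (2, x) \<and> f (3, x) = f' (3, x)"
  shows "f = f'"
proof (rule PiE_ext)
  show "f \<in> carrier c4d6 \<rightarrow>\<^sub>E carrier F" "f' \<in> carrier c4d6 \<rightarrow>\<^sub>E carrier F" using f by simp_all
  fix y assume "y \<in> carrier c4d6"
  then obtain i x where "y = (i, x)" "i \<in> {0, 1, 2, 3}" "x \<in> carrier (dihedral_group 6)"
    unfolding c4d6_carrier carrier_integer_mod_group_4 by blast
  then show "f y = f' y"
    using assms(3)[of x] by auto
qed

lemma units_group_algebra_split:
  fixes F (structure)
  assumes "field F" and fin: "finite (carrier F)"
    and two: "\<one> \<oplus> \<one> \<noteq> \<zero>" and three: "\<one> \<oplus> \<one> \<oplus> \<one> \<noteq> \<zero>"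
    and w: "w \<in> carrier F" "w \<otimes> w = \<ominus> \<one>"
  shows "units_of (group_algebra F c4d6) \<cong> units_of (group_power F 8 \<times>\<times> group_power (matrix_ring 2 F) 4)"
proof -
  interpret field F by fact
  \<comment> \<open>All fourth roots of unity, with opposite ones adjacent: indices 0, 1 have square
    1 and indices 2, 3 have square -1.\<close>
  define z where "z i = [\<one>, \<ominus> \<one>, w, \<ominus> w] ! i" for i
  have z: "root_eval_domain F F (\<lambda>x. x) (z i)" if "i < 4" for i
    using that w
    by (intro root_eval_domain_id[OF two three, of "z i" "z i \<otimes> z i"])
      (auto simp: z_def less_Suc_eq numeral_eq_Suc l_minus r_minus)
  define s where "s b = (if b then \<one> else \<ominus> \<one>)" for b
  have s: "s b \<in> carrier F" "s b \<otimes> s b = \<one>" for b by (simp_all add: s_def l_minus)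
  \<comment> \<open>The index modulo 4 selects the root; the first four characters are trivial on
    reflections, the last four take the sign.\<close>
  define \<chi> where "\<chi> i = c4d6_char F (\<lambda>x. x) (z (i mod 4)) (s (i < 4))" for i
  define \<rho> where "\<rho> i = c4d6_rep F (\<lambda>x. x) (z i)" for i
  define \<Psi> where "\<Psi> f = ((\<lambda>i\<in>{..<8::nat}. \<chi> i f), (\<lambda>i\<in>{..<4::nat}. \<rho> i f))" for f
  have \<chi>: "\<chi> i \<in> hom (group_algebra F c4d6) F" "\<chi> i \<one>\<^bsub>group_algebra F c4d6\<^esub> = \<one>" for i
    using root_eval.c4d6_char_hom[OF root_eval_domain.axioms(1)[OF z] s, of "i mod 4" "i < 4"]
    by (simp_all add: \<chi>_def)
  have \<rho>: "\<rho> i \<in> hom (group_algebra F c4d6) (matrix_ring 2 F)"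
    "\<rho> i \<one>\<^bsub>group_algebra F c4d6\<^esub> = \<one>\<^bsub>matrix_ring 2 F\<^esub>" if "i < 4" for i
    using root_eval.c4d6_rep_hom[OF root_eval_domain.axioms(1)[OF z[OF that]]] by (simp_all add: \<rho>_def)
  show ?thesis
  proof (rule units_of_iso_card)
    show "\<Psi> \<in> hom (group_algebra F c4d6) (group_power F 8 \<times>\<times> group_power (matrix_ring 2 F) 4)"
      unfolding \<Psi>_def hom_paired by (intro conjI group_power_hom \<chi> \<rho>)
    show "\<Psi> \<one>\<^bsub>group_algebra F c4d6\<^esub> = \<one>\<^bsub>group_power F 8 \<times>\<times> group_power (matrix_ring 2 F) 4\<^esub>"
      using \<chi>(2) \<rho>(2) by (simp add: \<Psi>_def fun_eq_iff del: group_algebra_simps matrix_ring_simps)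
    show "inj_on \<Psi> (carrier (group_algebra F c4d6))"
    proof (rule inj_onI)
      fix f f' assume f: "f \<in> carrier (group_algebra F c4d6)" and f': "f' \<in> carrier (group_algebra F c4d6)"
        and eq: "\<Psi> f = \<Psi> f'"
      have eq\<chi>: "\<chi> i f = \<chi> i f'" if "i < 8" for i
        using fun_cong[of _ _ i, OF arg_cong[OF eq, of fst]] that by (simp add: \<Psi>_def)
      have eq\<rho>: "\<rho> i f = \<rho> i f'" if "i < 4" for i
        using fun_cong[of _ _ i, OF arg_cong[OF eq, of snd]] that by (simp add: \<Psi>_def)
      have ev: "c4_eval F (\<lambda>x. x) (z i) f x = c4_eval F (\<lambda>x. x) (z i) f' x"
        if i: "i < 4" and x: "x \<in> carrier (dihedral_group 6)" for i x
        \<comment> \<open>The two characters and the representation that belong to the same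
          root.\<close>
        using i eq\<chi>[of i] eq\<chi>[of "i + 4"] eq\<rho>[of i]
        by (intro root_eval_domain.c4_eval_inj[OF z[OF i] f f' _ _ _ x]) (simp_all add: \<chi>_def \<rho>_def s_def)
      show "f = f'"
      proof (rule group_algebra_eqI[OF f f'])
        fix x assume x: "x \<in> carrier (dihedral_group 6)"
        have c: "g (i, x) \<in> carrier F" if "g \<in> carrier (group_algebra F c4d6)" "i \<in> {0, 1, 2, 3}" for g i
          using that x by (auto simp: c4d6_carrier PiE_iff carrier_integer_mod_group)
        note c [OF f, simp] c[OF f', simp]
        \<comment> \<open>The roots 1, -1 yield the sums of coefficients two places apart, the roots
          \<open>w\<close> and its negative the differences.\<close>
        note sums = root_eval_domain.c4_eval_pm_sums[OF z f f' x, of 0 "\<one>"]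
        note diffs = root_eval_domain.c4_eval_pm_sums[OF z f f' x, of 2 "\<ominus> \<one>"]
        have s: "f (0, x) \<oplus> f (2, x) = f' (0, x) \<oplus> f' (2, x)" "f (1, x) \<oplus> f (3, x) = f' (1, x) \<oplus> f' (3, x)"
          using sums ev[OF _ x, of 0] ev[OF _ x, of 1] by (simp_all add: z_def)
        have d: "f (0, x) \<ominus> f (2, x) = f' (0, x) \<ominus> f' (2, x)" "f (1, x) \<ominus> f (3, x) = f' (1, x) \<ominus> f' (3, x)"
          using diffs w ev[OF _ x, of 2] ev[OF _ x, of 3] by (simp_all add: z_def a_minus_def r_minus)
        show "f (0, x) = f' (0, x) \<and> f (1, x) = f' (1, x) \<and> f (2, x) = f' (2, x) \<and> f (3, x) = f' (3, x)"
          using sum_diff_cancel[OF two _ _ _ _ s(1) d(1)] sum_diff_cancel[OF two _ _ _ _ s(2) d(2)] by simp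
      qed
    qed
    show "finite (carrier (group_power F 8 \<times>\<times> group_power (matrix_ring 2 F) 4))"
      using fin by (auto intro!: finite_PiE)
    \<comment> \<open>Exponents of q: 24 = 8 + 4*4.\<close>
    show "card (carrier (group_algebra F c4d6)) = card (carrier (group_power F 8 \<times>\<times> group_power (matrix_ring 2 F) 4))"
      using fin by (simp add: card_funcsetE card_cartesian_product finite_c4d6 card_c4d6 card_matrix_ring
          power_mult[symmetric] power_add[symmetric] del: matrix_ring_simps)
  qed (blast intro: group_algebra_closed[OF c4d6_group is_ring])+
qed

text \<open>Linear independence of 1 and \<open>w\<close> over the image of \<open>h\<close>: if
  \<open>b\<close> and \<open>d\<close> differed, \<open>w\<close> would be the image of the
  quotient of \<open>c \<ominus> a\<close> by \<open>b \<ominus> d\<close>.\<close>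

lemma (in ring_hom_cring) adjoin_coeffs_unique:
  assumes F: "field R" and S: "field S" and w: "w \<in> carrier S" "w \<notin> h ` carrier R"
    and [simp]: "a \<in> carrier R" "b \<in> carrier R" "c \<in> carrier R" "d \<in> carrier R"
    and eq: "h a \<oplus>\<^bsub>S\<^esub> h b \<otimes>\<^bsub>S\<^esub> w = h c \<oplus>\<^bsub>S\<^esub> h d \<otimes>\<^bsub>S\<^esub> w"
  shows "a = c" "b = d"
proof -
  interpret F: field R by fact
  interpret S: field S by fact
  have H: "ring_hom_ring R S h"
    using homh by (rule ring_hom_ringI2[OF R.ring_axioms S.ring_axioms])
  have inj: "inj_on h (carrier R)"
    using ring_hom_ring.img_is_subfield(1)[OF H F.carrier_is_subfield] by simp
  show b: "b = d"
  proof (rule ccontr)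
    assume "b \<noteq> d"
    then have nz: "b \<ominus> d \<noteq> \<zero>" by simp
    then have u: "inv (b \<ominus> d) \<in> carrier R" "inv (b \<ominus> d) \<otimes> (b \<ominus> d) = \<one>"
      using F.field_Units by (auto intro: R.Units_inv_closed R.Units_l_inv)
    have "h (b \<ominus> d) \<otimes>\<^bsub>S\<^esub> w = (h a \<oplus>\<^bsub>S\<^esub> h b \<otimes>\<^bsub>S\<^esub> w) \<ominus>\<^bsub>S\<^esub> h a \<ominus>\<^bsub>S\<^esub> h d \<otimes>\<^bsub>S\<^esub> w"
      using w(1) by (simp add: a_minus_def S.l_distr S.l_minus) (simp add: S.a_assoc S.a_comm S.a_lcomm S.r_neg1 S.r_neg2)
    also have "\<dots> = h (c \<ominus> a)"
      unfolding eq using w(1) by (simp add: a_minus_def) (simp add: S.a_ac S.r_neg1 S.r_neg2 S.l_neg S.r_neg)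
    finally have "h (inv (b \<ominus> d)) \<otimes>\<^bsub>S\<^esub> (h (b \<ominus> d) \<otimes>\<^bsub>S\<^esub> w) = h (inv (b \<ominus> d) \<otimes> (c \<ominus> a))"
      using u by simp
    moreover have "h (inv (b \<ominus> d)) \<otimes>\<^bsub>S\<^esub> (h (b \<ominus> d) \<otimes>\<^bsub>S\<^esub> w) = h (inv (b \<ominus> d) \<otimes> (b \<ominus> d)) \<otimes>\<^bsub>S\<^esub> w"
      using u(1) w(1) by (simp only: hom_mult S.m_assoc hom_closed R.minus_closed assms)
    then have "h (inv (b \<ominus> d)) \<otimes>\<^bsub>S\<^esub> (h (b \<ominus> d) \<otimes>\<^bsub>S\<^esub> w) = w"
      by (simp only: u(2) hom_one S.l_one w(1))
    ultimately have "w = h (inv (b \<ominus> d) \<otimes> (c \<ominus> a))"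
      by argo
    moreover have "inv (b \<ominus> d) \<otimes> (c \<ominus> a) \<in> carrier R"
      using u(1) by simp
    ultimately show False using w(2) by (metis imageI)
  qed
  have "h a = h c"
    using eq w(1) unfolding b by simp
  then show "a = c" using inj by (simp add: inj_on_eq_iff)
qed

text \<open>The roots \<open>w\<close> and its negative are conjugate over \<open>F\<close>, so
  their characters and representations carry the same information and one of each pair is kept, with
  values in \<open>E\<close>.\<close>

lemma units_group_algebra_nonsplit:
  fixes F (structure)
  assumes "field F" and fin: "finite (carrier F)" and "field E" and finE: "finite (carrier E)"
    and card: "card (carrier E) = card (carrier F) ^ 2"
    and hom: "h \<in> ring_hom F E"
    and two: "\<one> \<oplus> \<one> \<noteq> \<zero>" and three: "\<one> \<oplus> \<one> \<oplus> \<one> \<noteq> \<zero>"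
    and w: "w \<in> carrier E" "w \<otimes>\<^bsub>E\<^esub> w = \<ominus>\<^bsub>E\<^esub> \<one>\<^bsub>E\<^esub>" "w \<notin> h ` carrier F"
  shows "units_of (group_algebra F c4d6) \<cong>
    units_of (group_power F 4 \<times>\<times> group_power E 2 \<times>\<times> group_power (matrix_ring 2 F) 2 \<times>\<times> matrix_ring 2 E)"
    (is "_ \<cong> units_of ?N")
proof -
  interpret field F by fact
  interpret E: field E by fact
  interpret h: ring_hom_ring F E h
    using hom by (rule ring_hom_ringI2[OF ring_axioms E.ring_axioms])
  interpret hc: ring_hom_cring F E h
    by (rule ring_hom_cringI[OF is_cring E.is_cring hom])
  have inj: "inj_on h (carrier F)"
    using h.img_is_subfield(1)[OF carrier_is_subfield] by simp
  have "h (\<one> \<oplus> \<one>) \<noteq> h \<zero>" "h (\<one> \<oplus> \<one> \<oplus> \<one>) \<noteq> h \<zero>"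
    using two three inj by (auto simp: inj_on_eq_iff simp del: h.hom_add h.hom_zero)
  then have two': "\<one>\<^bsub>E\<^esub> \<oplus>\<^bsub>E\<^esub> \<one>\<^bsub>E\<^esub> \<noteq> \<zero>\<^bsub>E\<^esub>" and three': "\<one>\<^bsub>E\<^esub> \<oplus>\<^bsub>E\<^esub> \<one>\<^bsub>E\<^esub> \<oplus>\<^bsub>E\<^esub> \<one>\<^bsub>E\<^esub> \<noteq> \<zero>\<^bsub>E\<^esub>"
    by simp_all
  define z where "z i = [\<one>, \<ominus> \<one>] ! i" for i
  have z: "root_eval_domain F F (\<lambda>x. x) (z i)" if "i < 2" for i
    using that
    by (intro root_eval_domain_id[OF two three, of "z i" "z i \<otimes> z i"])
      (auto simp: z_def less_Suc_eq numeral_eq_Suc l_minus r_minus)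
  have "w [^]\<^bsub>E\<^esub> (4::nat) = (w \<otimes>\<^bsub>E\<^esub> w) \<otimes>\<^bsub>E\<^esub> (w \<otimes>\<^bsub>E\<^esub> w)"
    using w(1) by (simp add: numeral_eq_Suc E.m_assoc)
  then have w4: "w [^]\<^bsub>E\<^esub> (4::nat) = \<one>\<^bsub>E\<^esub>" by (simp add: w(2) E.l_minus)
  interpret w: root_eval_domain F E h w
    using two' three' w(1) w4 hom by unfold_locales
  define s where "s b = (if b then \<one> else \<ominus> \<one>)" for b
  define s' where "s' b = (if b then \<one>\<^bsub>E\<^esub> else \<ominus>\<^bsub>E\<^esub> \<one>\<^bsub>E\<^esub>)" for b
  have s: "s b \<in> carrier F" "s b \<otimes> s b = \<one>" for b by (simp_all add: s_def l_minus)
  have s': "s' b \<in> carrier E" "s' b \<otimes>\<^bsub>E\<^esub> s' b = \<one>\<^bsub>E\<^esub>" for b by (simp_all add: s'_def E.l_minus)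
  define \<chi> where "\<chi> i = c4d6_char F (\<lambda>x. x) (z (i mod 2)) (s (i < 2))" for i
  \<comment> \<open>The root is fixed, so the two indices differ just in the sign on
    reflections.\<close>
  define \<chi>' where "\<chi>' i = c4d6_char E h w (s' (i = 0))" for i :: nat
  define \<rho> where "\<rho> i = c4d6_rep F (\<lambda>x. x) (z i)" for i
  define \<rho>' where "\<rho>' = c4d6_rep E h w"
  define \<Psi> where "\<Psi> f = ((\<lambda>i\<in>{..<4::nat}. \<chi> i f), (\<lambda>i\<in>{..<2::nat}. \<chi>' i f), (\<lambda>i\<in>{..<2::nat}. \<rho> i f), \<rho>' f)" for f
  have \<chi>: "\<chi> i \<in> hom (group_algebra F c4d6) F" "\<chi> i \<one>\<^bsub>group_algebra F c4d6\<^esub> = \<one>" for i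
    using root_eval.c4d6_char_hom[OF root_eval_domain.axioms(1)[OF z] s, of "i mod 2" "i < 2"]
    by (simp_all add: \<chi>_def)
  have \<rho>: "\<rho> i \<in> hom (group_algebra F c4d6) (matrix_ring 2 F)"
    "\<rho> i \<one>\<^bsub>group_algebra F c4d6\<^esub> = \<one>\<^bsub>matrix_ring 2 F\<^esub>" if "i < 2" for i
    using root_eval.c4d6_rep_hom[OF root_eval_domain.axioms(1)[OF z[OF that]]] by (simp_all add: \<rho>_def)
  have \<chi>': "\<chi>' i \<in> hom (group_algebra F c4d6) E" "\<chi>' i \<one>\<^bsub>group_algebra F c4d6\<^esub> = \<one>\<^bsub>E\<^esub>" for i
    using w.c4d6_char_hom[OF s'] by (simp_all add: \<chi>'_def)
  have \<rho>': "\<rho>' \<in> hom (group_algebra F c4d6) (matrix_ring 2 E)"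
    "\<rho>' \<one>\<^bsub>group_algebra F c4d6\<^esub> = \<one>\<^bsub>matrix_ring 2 E\<^esub>"
    using w.c4d6_rep_hom by (simp_all add: \<rho>'_def)
  show ?thesis
  proof (rule units_of_iso_card)
    show "\<Psi> \<in> hom (group_algebra F c4d6) ?N"
      unfolding \<Psi>_def hom_paired by (intro conjI group_power_hom \<chi> \<rho> \<chi>' \<rho>')
    show "\<Psi> \<one>\<^bsub>group_algebra F c4d6\<^esub> = \<one>\<^bsub>?N\<^esub>"
      using \<chi>(2) \<rho>(2) \<chi>'(2) \<rho>'(2) by (simp add: \<Psi>_def fun_eq_iff del: group_algebra_simps matrix_ring_simps)
    show "inj_on \<Psi> (carrier (group_algebra F c4d6))"
    proof (rule inj_onI)
      fix f f' assume f: "f \<in> carrier (group_algebra F c4d6)" and f': "f' \<in> carrier (group_algebra F c4d6)"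
        and eq: "\<Psi> f = \<Psi> f'"
      have eq\<chi>: "\<chi> i f = \<chi> i f'" if "i < 4" for i
        using fun_cong[of _ _ i, OF arg_cong[OF eq, of fst]] that by (simp add: \<Psi>_def)
      have eq\<rho>: "\<rho> i f = \<rho> i f'" if "i < 2" for i
        using fun_cong[of _ _ i, OF arg_cong[OF eq, of "\<lambda>y. fst (snd (snd y))"]] that by (simp add: \<Psi>_def)
      have eq\<chi>': "\<chi>' i f = \<chi>' i f'" if "i < 2" for i
        using fun_cong[of _ _ i, OF arg_cong[OF eq, of "\<lambda>y. fst (snd y)"]] that by (simp add: \<Psi>_def)
      have eq\<rho>': "\<rho>' f = \<rho>' f'"
        using eq by (simp add: \<Psi>_def)
      have ev: "c4_eval F (\<lambda>x. x) (z i) f x = c4_eval F (\<lambda>x. x) (z i) f' x"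
        if i: "i < 2" and x: "x \<in> carrier (dihedral_group 6)" for i x
        using i eq\<chi>[of i] eq\<chi>[of "i + 2"] eq\<rho>[of i]
        by (intro root_eval_domain.c4_eval_inj[OF z[OF i] f f' _ _ _ x]) (simp_all add: \<chi>_def \<rho>_def s_def)
      have ev': "c4_eval E h w f x = c4_eval E h w f' x" if x: "x \<in> carrier (dihedral_group 6)" for x
        using eq\<chi>'[of 0] eq\<chi>'[of 1] eq\<rho>'
        by (intro w.c4_eval_inj[OF f f' _ _ _ x]) (simp_all add: \<chi>'_def \<rho>'_def s'_def)
      show "f = f'"
      proof (rule group_algebra_eqI[OF f f'])
        fix x assume x: "x \<in> carrier (dihedral_group 6)"
        have c: "g (i, x) \<in> carrier F" if "g \<in> carrier (group_algebra F c4d6)" "i \<in> {0, 1, 2, 3}" for g i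
          using that x by (auto simp: c4d6_carrier PiE_iff carrier_integer_mod_group)
        note c [OF f, simp] c[OF f', simp]
        note sums = root_eval_domain.c4_eval_pm_sums[OF z f f' x, of 0 "\<one>"]
        have s: "f (0, x) \<oplus> f (2, x) = f' (0, x) \<oplus> f' (2, x)" "f (1, x) \<oplus> f (3, x) = f' (1, x) \<oplus> f' (3, x)"
          using sums ev[OF _ x, of 0] ev[OF _ x, of 1] by (simp_all add: z_def)
        \<comment> \<open>Since \<open>w\<close> squares to -1, the cubic collapses to degree one in
          \<open>w\<close>; its two coefficients are the differences that the split case took from
          two separate roots.\<close>
        have "h (g (0, x)) \<oplus>\<^bsub>E\<^esub> h (g (1, x)) \<otimes>\<^bsub>E\<^esub> w \<oplus>\<^bsub>E\<^esub> h (g (2, x)) \<otimes>\<^bsub>E\<^esub> (w \<otimes>\<^bsub>E\<^esub> w) \<oplus>\<^bsub>E\<^esub> h (g (3, x)) \<otimes>\<^bsub>E\<^esub> (w \<otimes>\<^bsub>E\<^esub> w \<otimes>\<^bsub>E\<^esub> w)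
            = h (g (0, x) \<ominus> g (2, x)) \<oplus>\<^bsub>E\<^esub> h (g (1, x) \<ominus> g (3, x)) \<otimes>\<^bsub>E\<^esub> w"
          if "g \<in> carrier (group_algebra F c4d6)" for g
        proof -
          note c[OF that, simp]
          show ?thesis
            unfolding w(2) using w(1)
            by (simp add: a_minus_def E.l_distr E.l_minus E.r_minus E.a_ac)
        qed
        then have "h (f (0, x) \<ominus> f (2, x)) \<oplus>\<^bsub>E\<^esub> h (f (1, x) \<ominus> f (3, x)) \<otimes>\<^bsub>E\<^esub> w
            = h (f' (0, x) \<ominus> f' (2, x)) \<oplus>\<^bsub>E\<^esub> h (f' (1, x) \<ominus> f' (3, x)) \<otimes>\<^bsub>E\<^esub> w"
          using ev'[OF x] f f' by (simp only: w.c4_eval_eq[OF _ x])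
        from hc.adjoin_coeffs_unique[OF field_axioms E.field_axioms w(1,3) _ _ _ _ this]
        have d: "f (0, x) \<ominus> f (2, x) = f' (0, x) \<ominus> f' (2, x)" "f (1, x) \<ominus> f (3, x) = f' (1, x) \<ominus> f' (3, x)"
          by simp_all
        show "f (0, x) = f' (0, x) \<and> f (1, x) = f' (1, x) \<and> f (2, x) = f' (2, x) \<and> f (3, x) = f' (3, x)"
          using sum_diff_cancel[OF two _ _ _ _ s(1) d(1)] sum_diff_cancel[OF two _ _ _ _ s(2) d(2)] by simp
      qed
    qed
    show "finite (carrier ?N)"
      using fin finE by (auto intro!: finite_PiE)
    \<comment> \<open>Exponents of q: 24 = 4 + 2*2 + 2*4 + 2*4, with an extra factor 2 for each part
      over \<open>E\<close>.\<close>
    show "card (carrier (group_algebra F c4d6)) = card (carrier ?N)"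
      using fin finE by (simp add: card_funcsetE card_cartesian_product finite_c4d6 card_c4d6 card_matrix_ring card
          power_mult[symmetric] power_add[symmetric] del: matrix_ring_simps)
  qed (blast intro: group_algebra_closed[OF c4d6_group is_ring])+
qed

section \<open>From the characteristic and the residue of \<open>q\<close> to the two
  decompositions\<close>

lemma (in ring) characteristic_add_pow:
  "[n] \<cdot> \<one> = \<zero> \<longleftrightarrow> characteristic R dvd n"
  using add.pow_eq_id[of \<one> n] by (simp add: characteristic_def add_pow_def)

theorem theorem2p7:
  fixes F :: "('a, 'm) ring_scheme" and F2 :: "('b, 'n) ring_scheme" and p k q :: nat
    and G :: "(int \<times> int \<times> bool) monoid"
  assumes "field F" and "finite (carrier F)"
    and "characteristic F = p"
    and "card (carrier F) = q" and "q = p ^ k"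
    and "G = integer_mod_group 4 \<times>\<times> dihedral_group 6"
    and "p > 3"
  shows
    "([q = 1] (mod 12) \<or> [q = 5] (mod 12) \<longrightarrow>
      units_of (group_algebra F G) \<cong>
        group_power (integer_mod_group (p ^ k - 1)) 8 \<times>\<times> group_power (GL 2 F) 4) \<and>
     ([int q = -1] (mod 12) \<or> [int q = -5] (mod 12) \<longrightarrow> extension_of_degree 2 F F2 \<longrightarrow>
      units_of (group_algebra F G) \<cong>
        group_power (integer_mod_group (p ^ k - 1)) 4 \<times>\<times>
        group_power (integer_mod_group (p ^ (2 * k) - 1)) 2 \<times>\<times>
        group_power (GL 2 F) 2 \<times>\<times> GL 2 F2)"
proof -
  interpret F: field F by fact
  have G: "G = c4d6" by (simp add: assms(6) c4d6_def)
  have "\<not> p dvd 2" "\<not> p dvd 3"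
    using \<open>p > 3\<close> by (auto dest: dvd_imp_le)
  then have two: "\<one>\<^bsub>F\<^esub> \<oplus>\<^bsub>F\<^esub> \<one>\<^bsub>F\<^esub> \<noteq> \<zero>\<^bsub>F\<^esub>" and three: "\<one>\<^bsub>F\<^esub> \<oplus>\<^bsub>F\<^esub> \<one>\<^bsub>F\<^esub> \<oplus>\<^bsub>F\<^esub> \<one>\<^bsub>F\<^esub> \<noteq> \<zero>\<^bsub>F\<^esub>"
    using F.characteristic_add_pow[of 2] F.characteristic_add_pow[of 3] assms(3)
    by (simp_all add: numeral_eq_Suc)
  have card: "card (carrier F) = p ^ k" using assms(4,5) by simp
  have FU: "group_power (units_of F) m \<cong> group_power (integer_mod_group (p ^ k - 1)) m" for m
    using F.units_of_finite_field_iso[OF assms(2)] by (intro group_power_iso) (simp add: card)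
  have gF: "group (group_power (units_of F) m)" for m
    by (intro group_group_power F.units_group)
  have gGL: "group (GL 2 F)"
    unfolding GL_def using F.matrix_ring_is_ring by (intro monoid.units_group ring.is_monoid)
  show ?thesis
  proof (intro conjI impI)
    assume "[q = 1] (mod 12) \<or> [q = 5] (mod 12)"
    then have "q mod 12 = 1 \<or> q mod 12 = 5"
      by (simp add: cong_def)
    \<comment> \<open>The residue modulo 3 is dropped: the representation of \<open>D_6\<close>
      involves no cube roots of unity.\<close>
    then have "q mod 4 = 1" by presburger
    then have "4 dvd card (carrier F) - 1"
      using mod_eq_dvd_iff_nat[of 1 q 4] assms(4) by (cases "q = 0") simp_all
    then obtain w where "w \<in> carrier F" "w \<otimes>\<^bsub>F\<^esub> w = \<ominus>\<^bsub>F\<^esub> \<one>\<^bsub>F\<^esub>"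
      using F.sqrt_minus_one_exists[OF assms(2)] by blast
    then have "units_of (group_algebra F G) \<cong> group_power (units_of F) 8 \<times>\<times> group_power (GL 2 F) 4"
      using units_group_algebra_split[OF assms(1,2) two three]
      by (simp add: G GL_def units_of_DirProd units_of_group_power)
    also have "\<dots> \<cong> group_power (integer_mod_group (p ^ k - 1)) 8 \<times>\<times> group_power (GL 2 F) 4"
      by (intro group.DirProd_iso_trans gF FU iso_refl)
    finally show "units_of (group_algebra F G) \<cong>
        group_power (integer_mod_group (p ^ k - 1)) 8 \<times>\<times> group_power (GL 2 F) 4" .
  next
    assume "[int q = -1] (mod 12) \<or> [int q = -5] (mod 12)" and "extension_of_degree 2 F F2"
    then obtain h where "field F2" and hom: "h \<in> ring_hom F F2"
      and dim: "ring.dimension F2 2 (h ` carrier F) (carrier F2)"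
      by (auto simp: extension_of_degree_def)
    interpret E: field F2 by fact
    interpret h: ring_hom_ring F F2 h
      using hom by (rule ring_hom_ringI2[OF F.ring_axioms E.ring_axioms])
    have inj: "inj_on h (carrier F)" and sub: "subfield (h ` carrier F) F2"
      using h.img_is_subfield[OF F.carrier_is_subfield] by simp_all
    have finE: "finite (carrier F2)" and cardE: "card (carrier F2) = q ^ 2"
      using E.card_dimension[OF dim sub] assms(2,4) card_image[OF inj] by simp_all
    have "int q mod 12 = 11 \<or> int q mod 12 = 7"
      using \<open>[int q = -1] (mod 12) \<or> [int q = -5] (mod 12)\<close> by (simp add: cong_def)
    then have "q mod 4 = 3" by presburger
    then obtain m where m: "q = 4 * m + 3"
      by (metis mult_div_mod_eq)
    \<comment> \<open>So 4 divides the number of units of \<open>F2\<close>, although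
      \<open>F\<close> has 4m + 2 units: a square root of -1 appears exactly in the
      extension.\<close>
    have "q ^ 2 - 1 = 4 * (4 * m ^ 2 + 6 * m + 2)"
      by (simp add: m power2_eq_square algebra_simps)
    then obtain w where w: "w \<in> carrier F2" "w \<otimes>\<^bsub>F2\<^esub> w = \<ominus>\<^bsub>F2\<^esub> \<one>\<^bsub>F2\<^esub>"
      using E.sqrt_minus_one_exists[OF finE] by (metis cardE dvd_triv_left)
    have "w \<notin> h ` carrier F"
    proof
      assume "w \<in> h ` carrier F"
      then obtain c where c: "c \<in> carrier F" "w = h c" by auto
      then have "h (c \<otimes>\<^bsub>F\<^esub> c) = h (\<ominus>\<^bsub>F\<^esub> \<one>\<^bsub>F\<^esub>)" using w by simp
      then have "c \<otimes>\<^bsub>F\<^esub> c = \<ominus>\<^bsub>F\<^esub> \<one>\<^bsub>F\<^esub>"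
        using inj c(1) by (meson F.a_inv_closed F.m_closed F.one_closed inj_onD)
      then show False
        using F.no_sqrt_minus_one[OF assms(2) _ two c(1)] m assms(4) by blast
    qed
    then have "units_of (group_algebra F G) \<cong> group_power (units_of F) 4 \<times>\<times>
        group_power (units_of F2) 2 \<times>\<times> group_power (GL 2 F) 2 \<times>\<times> GL 2 F2"
      using units_group_algebra_nonsplit[OF assms(1,2) E.field_axioms finE _ hom two three w] cardE assms(4)
      by (simp add: G GL_def units_of_DirProd units_of_group_power)
    also have "\<dots> \<cong> group_power (integer_mod_group (p ^ k - 1)) 4 \<times>\<times>
        group_power (integer_mod_group (p ^ (2 * k) - 1)) 2 \<times>\<times> group_power (GL 2 F) 2 \<times>\<times> GL 2 F2"
    proof (intro group.DirProd_iso_trans gF FU iso_refl group_group_power E.units_group gGL)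
      have "card (carrier F2) = p ^ (2 * k)"
        using cardE assms(5) by (simp add: power_mult[symmetric] mult.commute)
      then show "group_power (units_of F2) 2 \<cong> group_power (integer_mod_group (p ^ (2 * k) - 1)) 2"
        using E.units_of_finite_field_iso[OF finE] by (intro group_power_iso) simp
    qed
    finally show "units_of (group_algebra F G) \<cong>
        group_power (integer_mod_group (p ^ k - 1)) 4 \<times>\<times>
        group_power (integer_mod_group (p ^ (2 * k) - 1)) 2 \<times>\<times>
        group_power (GL 2 F) 2 \<times>\<times> GL 2 F2" .
  qed
qed

end
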